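(* Let $A$ be a nonnegative integer-valued random variable and $\{B_i\}_{i\ge1}$ i.i.d. nonnegative integer-valued random variables with the law of $B$, with $A$ and $\{B_i\}_{i\ge1}$ independent. Assume $\mathbb P(A>x)\sim(1+x)^{-1}$ as $x\to\infty$; $\mathbb P(B>x)=L(x)/(1+x)$ with $L$ slowly varying and $L(x)\sim(\log x)^{-1-\varepsilon}$ for some $\varepsilon>0$; and $b:=\mathbb E B\in(0,1)$. Let $X$ satisfy $X\stackrel{d}{=}A+\sum_{i=1}^{X}B_i$. Let $D_n$ ($n\ge1$) be the branching aggregates of $B$, let $\{A_n\}_{n\ge1}$ be i.i.d. copies of $A$, and for each $n\ge1$ let $\{D_{n,i}\}_{i\ge1}$ be i.i.d. copies of $D_n$, all these families being mutually independent. Then, as $x\to\infty$, $$\mathbb P(X>x)\ \sim\ \mathbb P(A>x)+\sum_{n\ge1}\mathbb P\Big(\sum_{i=1}^{A_{n+1}}D_{n,i}>x\Big),$$ and for each fixed $n\ge1$, as $x\to\infty$, $$\mathbb P\Big(\sum_{i=1}^{A_{n+1}}D_{n,i}>x\Big)\ \sim\ \mathbb E\big[A\,\mathbf 1\{A\le x\,b^{-n}\}\big]\cdot n\,b^{\,n-1}\,\mathbb P(B>x)+\mathbb P(A>x\,b^{-n}).$$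
   Context: $\stackrel{d}{=}$ denotes equality in distribution; $f(x)\sim g(x)$ means $f(x)/g(x)\to1$ as $x\to\infty$. A measurable $L:(0,\infty)\to(0,\infty)$ is slowly varying if $L(tx)/L(x)\to1$ as $x\to\infty$ for each $t>0$. Fixed point: $X$ is a (finite) nonnegative integer-valued random variable such that, when $X$, $A$ and $\{B_i\}_{i\ge1}$ are taken independent on the right-hand side, $A+\sum_{i=1}^X B_i$ has the same distribution as $X$. Branching aggregates of $B$: the laws of $D_n$, $n\ge1$, are defined recursively by $D_1\stackrel{d}{=}B$ and $D_{n+1}\stackrel{d}{=}\sum_{i=1}^{B}D_{n,i}$ for $n\ge1$, where $\{D_{n,i}\}_{i\ge1}$ are i.i.d. copies of $D_n$ independent of $B$. *)

theory Defs
  imports "HOL-Probability.Probability" "HOL-Library.Landau_Symbols"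
begin

definition slowly_varying :: "(real \<Rightarrow> real) \<Rightarrow> bool" where
  "slowly_varying L \<longleftrightarrow>
     L \<in> borel_measurable (restrict_space borel {0<..}) \<and>
     (\<forall>x>0. L x > 0) \<and>
     (\<forall>t>0. ((\<lambda>x. L (t * x) / L x) \<longlongrightarrow> 1) at_top)"

definition eq_law :: "'a measure \<Rightarrow> ('a \<Rightarrow> nat) \<Rightarrow> ('a \<Rightarrow> nat) \<Rightarrow> bool" where
  "eq_law M Y Z \<longleftrightarrow> distr M (count_space UNIV) Y = distr M (count_space UNIV) Z"

abbreviation indep_nat_vars ::
    "'a measure \<Rightarrow> ('i \<Rightarrow> 'a \<Rightarrow> nat) \<Rightarrow> 'i set \<Rightarrow> bool" where
  "indep_nat_vars M Y I \<equiv> prob_space.indep_vars M (\<lambda>_. count_space UNIV) Y I"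

abbreviation tail :: "'a measure \<Rightarrow> ('a \<Rightarrow> nat) \<Rightarrow> real \<Rightarrow> real" where
  "tail M Y x \<equiv> \<P>(\<omega> in M. real (Y \<omega>) > x)"

text \<open>
  Sequences such as \<open>B\<^sub>1, B\<^sub>2, \<dots>\<close> are indexed from 1; the value at index 0 is ignored.
  The function \<open>with_head Z Y\<close> is the family \<open>Z, Y\<^sub>1, Y\<^sub>2, \<dots>\<close>, used to state
  joint independence of \<open>Z\<close> and the whole sequence.
\<close>

definition with_head :: "('a \<Rightarrow> nat) \<Rightarrow> (nat \<Rightarrow> 'a \<Rightarrow> nat) \<Rightarrow> nat \<Rightarrow> 'a \<Rightarrow> nat" where
  "with_head Z Y i = (if i = 0 then Z else Y i)"

definition random_sum :: "('a \<Rightarrow> nat) \<Rightarrow> (nat \<Rightarrow> 'a \<Rightarrow> nat) \<Rightarrow> 'a \<Rightarrow> nat" where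
  "random_sum N Y \<omega> = (\<Sum>i=1..N \<omega>. Y i \<omega>)"

text \<open>
  The equation \<open>X = A + B\<^sub>1 + \<dots> + B\<^sub>X\<close> in law only constrains the law of \<open>X\<close>: on the right-hand side
  \<open>X\<close> is replaced by a copy \<open>X'\<close> that is independent of \<open>A\<close> and the \<open>B\<^sub>i\<close>, while \<open>X\<close> itself
  may depend on them.  Index \<open>None\<close> is \<open>X'\<close>, index \<open>Some 0\<close> is \<open>A\<close>, index \<open>Some i\<close> is \<open>B\<^sub>i\<close>.
\<close>

definition fixed_point ::
    "'a measure \<Rightarrow> ('a \<Rightarrow> nat) \<Rightarrow> ('a \<Rightarrow> nat) \<Rightarrow> (nat \<Rightarrow> 'a \<Rightarrow> nat) \<Rightarrow> bool" where
  "fixed_point M X A Bs \<longleftrightarrow>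
     X \<in> measurable M (count_space UNIV) \<and>
     (\<exists>X'. eq_law M X' X \<and>
           indep_nat_vars M (case_option X' (with_head A Bs)) UNIV \<and>
           eq_law M X (\<lambda>\<omega>. A \<omega> + random_sum X' Bs \<omega>))"

text \<open>
  For each \<open>n \<ge> 1\<close>, \<open>D n 1, D n 2, \<dots>\<close> are i.i.d. copies of \<open>D\<^sub>n\<close>, independent of \<open>B\<close>; nothing is
  required here about the joint law for different values of \<open>n\<close>.
\<close>

definition branching_aggregates ::
    "'a measure \<Rightarrow> ('a \<Rightarrow> nat) \<Rightarrow> (nat \<Rightarrow> nat \<Rightarrow> 'a \<Rightarrow> nat) \<Rightarrow> bool" where
  "branching_aggregates M B D \<longleftrightarrow>
     (\<forall>n\<ge>1. indep_nat_vars M (with_head B (D n)) UNIV) \<and>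
     (\<forall>i\<ge>1. eq_law M (D 1 i) B) \<and>
     (\<forall>n\<ge>1. \<forall>i\<ge>1. eq_law M (D (n + 1) i) (random_sum B (D n)))"

end

theory Submission
  imports Defs "HOL-Real_Asymp.Real_Asymp"
begin

text \<open>
  Since \<open>\<epsilon> > 0\<close>, the term \<open>E[A; A \<le> x/b\<^sup>n] P(B > x)\<close> is of order
  \<open>1 / (x (log x)\<^sup>\<epsilon>) = o(1/x)\<close>, so every tail in the theorem is asymptotic to a constant over \<open>x\<close>.
  The key one-step estimate says that a random sum \<open>\<Sum>\<^sub>i\<^sub>\<le>\<^sub>N B\<^sub>i\<close> satisfies
  \<open>P(\<Sum> > x) \<le> P(N > x/\<rho>) + o(1/x)\<close> for each \<open>\<rho> > b\<close>, as soon as \<open>E[N; N \<le> x] = O(log x)\<close>: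
  truncate the summands at \<open>x\<close> and apply Chebyshev's inequality, using
  \<open>E[min(B, x)\<^sup>2] = o(x / log x)\<close>.  The weak law of large numbers gives the matching lower bound
  with \<open>\<rho> < b\<close>.

  As \<open>D\<^sub>n\<^sub>+\<^sub>1\<close> is also the random sum of \<open>D\<^sub>n\<close> copies of \<open>B\<close>, the law of
  \<open>\<Sum>\<^sub>i\<^sub>\<le>\<^sub>A D\<^sub>n\<^sub>,\<^sub>i\<close> arises from that of \<open>A\<close> by \<open>n\<close> such steps, so its tail is \<open>\<sim> b\<^sup>n / x\<close>,
  with bounds summable in \<open>n\<close>; Tannery's theorem yields \<open>b / ((1 - b) x)\<close> for the sum over \<open>n\<close>.
  For \<open>X\<close> the same step turns the fixed point equation into
  \<open>P(X > x) \<approx> 1/x + P(X > x/b)\<close>, which is iterated towards infinity and gives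
  \<open>P(X > x) \<sim> 1 / ((1 - b) x)\<close> directly.
\<close>

section \<open>Random sums of probability mass functions\<close>

definition conv_pmf :: "nat pmf \<Rightarrow> nat pmf \<Rightarrow> nat pmf" where
  "conv_pmf p q = map_pmf (\<lambda>(x, y). x + y) (pair_pmf p q)"

primrec iid_sum_pmf :: "nat pmf \<Rightarrow> nat \<Rightarrow> nat pmf" where
  "iid_sum_pmf q 0 = return_pmf 0"
| "iid_sum_pmf q (Suc n) = conv_pmf q (iid_sum_pmf q n)"

definition random_sum_pmf :: "nat pmf \<Rightarrow> nat pmf \<Rightarrow> nat pmf" where
  "random_sum_pmf p q = bind_pmf p (iid_sum_pmf q)"

abbreviation tail_pmf :: "nat pmf \<Rightarrow> real \<Rightarrow> real" where
  "tail_pmf p x \<equiv> measure_pmf.prob p {n. x < real n}"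

abbreviation truncated_mean :: "nat pmf \<Rightarrow> real \<Rightarrow> real" where
  "truncated_mean p K \<equiv> measure_pmf.expectation p (\<lambda>n. min (real n) K)"

lemma conv_pmf_altdef: "conv_pmf p q = bind_pmf p (\<lambda>x. bind_pmf q (\<lambda>y. return_pmf (x + y)))"
  by (simp add: conv_pmf_def pair_pmf_def map_bind_pmf)

lemma conv_pmf_return_0 [simp]: "conv_pmf (return_pmf 0) q = q"
  by (simp add: conv_pmf_altdef bind_return_pmf bind_return_pmf')

lemma conv_pmf_assoc: "conv_pmf (conv_pmf p q) r = conv_pmf p (conv_pmf q r)"
  by (simp add: conv_pmf_altdef bind_assoc_pmf bind_return_pmf add.assoc)

lemma conv_bind_pmf:
  "conv_pmf (bind_pmf p f) (bind_pmf q g) =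
     bind_pmf p (\<lambda>x. bind_pmf q (\<lambda>y. conv_pmf (f x) (g y)))"
  unfolding conv_pmf_altdef bind_assoc_pmf
  by (subst bind_commute_pmf[of q]) simp

lemma iid_sum_pmf_add: "iid_sum_pmf q (m + n) = conv_pmf (iid_sum_pmf q m) (iid_sum_pmf q n)"
  by (induction m) (simp_all add: conv_pmf_assoc)

lemma random_sum_pmf_return_0 [simp]: "random_sum_pmf (return_pmf 0) q = return_pmf 0"
  by (simp add: random_sum_pmf_def bind_return_pmf)

lemma random_sum_pmf_conv:
  "random_sum_pmf (conv_pmf p q) r = conv_pmf (random_sum_pmf p r) (random_sum_pmf q r)"
  unfolding random_sum_pmf_def conv_bind_pmf
  by (simp add: conv_pmf_altdef[of p q] bind_assoc_pmf bind_return_pmf iid_sum_pmf_add)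

lemma iid_sum_random_sum_pmf:
  "iid_sum_pmf (random_sum_pmf q r) n = random_sum_pmf (iid_sum_pmf q n) r"
  by (induction n) (simp_all add: random_sum_pmf_conv)

lemma random_sum_pmf_assoc:
  "random_sum_pmf (random_sum_pmf p q) r = random_sum_pmf p (random_sum_pmf q r)"
proof -
  have "iid_sum_pmf (random_sum_pmf q r) = (\<lambda>n. random_sum_pmf (iid_sum_pmf q n) r)"
    by (simp add: fun_eq_iff iid_sum_random_sum_pmf)
  then have "random_sum_pmf p (random_sum_pmf q r) = bind_pmf p (\<lambda>n. random_sum_pmf (iid_sum_pmf q n) r)"
    by (simp add: random_sum_pmf_def[of p])
  then show ?thesis by (simp add: random_sum_pmf_def bind_assoc_pmf)
qed

lemma integrable_measure_pmf_bounded: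
  fixes f :: "'a \<Rightarrow> real"
  assumes "\<And>x. \<bar>f x\<bar> \<le> C"
  shows "integrable (measure_pmf p) f"
  by (rule measure_pmf.integrable_const_bound[where B = C]) (use assms in auto)

lemma expectation_bind_pmf:
  fixes f :: "'b \<Rightarrow> real"
  assumes f: "\<And>x. 0 \<le> f x" "\<And>x. f x \<le> C"
  shows "measure_pmf.expectation (bind_pmf p g) f =
    measure_pmf.expectation p (\<lambda>x. measure_pmf.expectation (g x) f)"
proof -
  have C: "\<bar>f x\<bar> \<le> C" for x using f[of x] by auto
  have int: "integrable (measure_pmf r) f" for r
    by (rule integrable_measure_pmf_bounded[OF C])
  have E: "0 \<le> measure_pmf.expectation (g x) f" "measure_pmf.expectation (g x) f \<le> C" for x
    using f by (auto intro!: integral_nonneg_AE measure_pmf.integral_le_const int)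
  have int2: "integrable (measure_pmf p) (\<lambda>x. measure_pmf.expectation (g x) f)"
    by (rule integrable_measure_pmf_bounded[where C = C]) (use E in auto)
  have "ennreal (measure_pmf.expectation (bind_pmf p g) f) = (\<integral>\<^sup>+x. f x \<partial>bind_pmf p g)"
    by (rule nn_integral_eq_integral[symmetric]) (auto simp: f int)
  also have "\<dots> = (\<integral>\<^sup>+x. \<integral>\<^sup>+y. f y \<partial>g x \<partial>p)" by simp
  also have "\<dots> = (\<integral>\<^sup>+x. measure_pmf.expectation (g x) f \<partial>p)"
    by (intro nn_integral_cong nn_integral_eq_integral) (auto simp: f int)
  also have "\<dots> = ennreal (measure_pmf.expectation p (\<lambda>x. measure_pmf.expectation (g x) f))"
    by (rule nn_integral_eq_integral) (auto simp: int2 E)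
  finally show ?thesis
    by (subst (asm) ennreal_inj) (auto intro!: integral_nonneg_AE simp: f E)
qed

lemma prob_bind_pmf:
  "measure_pmf.prob (bind_pmf p g) S = measure_pmf.expectation p (\<lambda>x. measure_pmf.prob (g x) S)"
  using expectation_bind_pmf[of "indicator S" 1 p g] by (simp add: indicator_def[of S])

lemma integrable_min_of_nat [simp]: "integrable (measure_pmf p) (\<lambda>n. min (real (f n)) K)"
  by (rule integrable_measure_pmf_bounded[where C = "\<bar>K\<bar>"]) auto

lemma truncated_mean_conv_pmf_le:
  assumes "0 \<le> K"
  shows "truncated_mean (conv_pmf p q) K \<le> truncated_mean p K + truncated_mean q K"
proof -
  have "truncated_mean (conv_pmf p q) K
      = measure_pmf.expectation (pair_pmf p q) (\<lambda>z. min (real (fst z + snd z)) K)"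
    by (simp add: conv_pmf_def case_prod_unfold)
  also have "\<dots> \<le> measure_pmf.expectation (pair_pmf p q)
      (\<lambda>z. min (real (fst z)) K + min (real (snd z)) K)"
    by (intro integral_mono Bochner_Integration.integrable_add integrable_min_of_nat)
      (use assms in auto)
  also have "\<dots> = truncated_mean p K + truncated_mean q K"
    using expectation_pair_pmf_fst[of p q "\<lambda>n. min (real n) K"]
      expectation_pair_pmf_snd[of p q "\<lambda>n. min (real n) K"]
    by (subst Bochner_Integration.integral_add) (simp_all only: integrable_min_of_nat)
  finally show ?thesis .
qed

lemma truncated_mean_iid_sum_pmf_le:
  assumes "0 \<le> K"
  shows "truncated_mean (iid_sum_pmf q n) K \<le> real n * truncated_mean q K"
proof (induction n)
  case (Suc n)
  then show ?case
    using truncated_mean_conv_pmf_le[OF assms, of q "iid_sum_pmf q n"] by (simp add: algebra_simps)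
qed (use assms in simp)

lemma truncated_mean_le_const: "truncated_mean p K \<le> K"
  by (intro measure_pmf.integral_le_const) auto

lemma truncated_mean_nonneg: "0 \<le> K \<Longrightarrow> 0 \<le> truncated_mean p K"
  by (intro integral_nonneg_AE) auto

lemma truncated_mean_random_sum_pmf_le:
  assumes "0 \<le> K" and b: "\<And>K. truncated_mean q K \<le> b"
  shows "truncated_mean (random_sum_pmf p q) K
    \<le> measure_pmf.expectation p (\<lambda>n. min (b * real n) K)"
proof -
  have b0: "0 \<le> b" using b[of 0] by simp
  have "truncated_mean (random_sum_pmf p q) K =
      measure_pmf.expectation p (\<lambda>n. truncated_mean (iid_sum_pmf q n) K)"
    unfolding random_sum_pmf_def by (rule expectation_bind_pmf[where C = K]) (use assms in auto)
  also have "\<dots> \<le> measure_pmf.expectation p (\<lambda>n. min (b * real n) K)"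
  proof (rule integral_mono)
    fix n
    have "truncated_mean (iid_sum_pmf q n) K \<le> real n * truncated_mean q K"
      by (rule truncated_mean_iid_sum_pmf_le[OF assms(1)])
    also have "\<dots> \<le> b * real n" using mult_left_mono[OF b, of "real n" K] by (simp add: mult.commute)
    finally show "truncated_mean (iid_sum_pmf q n) K \<le> min (b * real n) K"
      using truncated_mean_le_const by simp
  qed (auto intro!: integrable_measure_pmf_bounded[where C = K]
      simp: truncated_mean_le_const truncated_mean_nonneg assms b0)
  finally show ?thesis .
qed

lemma tail_conv_pmf_ge:
  "tail_pmf p x + tail_pmf q x - tail_pmf p x * tail_pmf q x \<le> tail_pmf (conv_pmf p q) x"
proof -
  let ?S = "{n. x < real n}" and ?P = "pair_pmf p q"
  have fst: "measure_pmf.prob ?P (?S \<times> UNIV) = tail_pmf p x"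
    and snd: "measure_pmf.prob ?P (UNIV \<times> ?S) = tail_pmf q x"
    and both: "measure_pmf.prob ?P (?S \<times> ?S) = tail_pmf p x * tail_pmf q x"
    by (simp_all add: measure_pmf_prob_product)
  have "measure_pmf.prob ?P (?S \<times> UNIV \<union> UNIV \<times> ?S)
      = tail_pmf p x + tail_pmf q x - tail_pmf p x * tail_pmf q x"
    using measure_pmf.finite_measure_Union'[of "?S \<times> UNIV" ?P "UNIV \<times> ?S"]
      measure_pmf.finite_measure_Diff'[of "UNIV \<times> ?S" ?P "?S \<times> UNIV"]
    by (simp add: fst snd both Times_Int_Times)
  moreover have "measure_pmf.prob ?P (?S \<times> UNIV \<union> UNIV \<times> ?S) \<le> tail_pmf (conv_pmf p q) x"
    by (auto simp: conv_pmf_def intro!: measure_pmf.finite_measure_mono)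
  ultimately show ?thesis by simp
qed

lemma tail_conv_pmf_le:
  assumes "x = y + z"
  shows "tail_pmf (conv_pmf p q) x \<le> tail_pmf p y + tail_pmf q y + tail_pmf p z * tail_pmf q z"
proof -
  let ?S = "\<lambda>x. {n. x < real n}" and ?P = "pair_pmf p q"
  have "tail_pmf (conv_pmf p q) x
      \<le> measure_pmf.prob ?P ((?S y \<times> UNIV \<union> UNIV \<times> ?S y) \<union> ?S z \<times> ?S z)"
    using assms by (auto simp: conv_pmf_def intro!: measure_pmf.finite_measure_mono)
  also have "\<dots> \<le> measure_pmf.prob ?P (?S y \<times> UNIV) + measure_pmf.prob ?P (UNIV \<times> ?S y)
      + measure_pmf.prob ?P (?S z \<times> ?S z)"
    by (intro order.trans[OF measure_Un_le] add_mono order.refl) simp_all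
  also have "\<dots> = tail_pmf p y + tail_pmf q y + tail_pmf p z * tail_pmf q z"
    by (simp add: measure_pmf_prob_product)
  finally show ?thesis .
qed

section \<open>Chebyshev bounds for random sums\<close>

lemma expectation_mult_pair_pmf:
  fixes f :: "'a \<Rightarrow> real" and g :: "'b \<Rightarrow> real"
  assumes "finite (set_pmf p)" "finite (set_pmf q)"
  shows "measure_pmf.expectation (pair_pmf p q) (\<lambda>z. f (fst z) * g (snd z)) =
    measure_pmf.expectation p f * measure_pmf.expectation q g"
proof -
  have "measure_pmf.expectation (pair_pmf p q) (\<lambda>z. f (fst z) * g (snd z)) =
     (\<Sum>z\<in>set_pmf p \<times> set_pmf q. f (fst z) * g (snd z) * pmf (pair_pmf p q) z)"
    by (rule integral_measure_pmf_real) (use assms in auto)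
  also have "\<dots> = (\<Sum>x\<in>set_pmf p. \<Sum>y\<in>set_pmf q. (f x * pmf p x) * (g y * pmf q y))"
    by (simp add: sum.cartesian_product case_prod_unfold pmf_pair[symmetric] mult_ac)
  also have "\<dots> = (\<Sum>x\<in>set_pmf p. f x * pmf p x) * (\<Sum>y\<in>set_pmf q. g y * pmf q y)"
    by (simp add: sum_product)
  also have "\<dots> = measure_pmf.expectation p f * measure_pmf.expectation q g"
    by (subst (1 2) integral_measure_pmf_real[of "set_pmf _"]) (use assms in auto)
  finally show ?thesis .
qed

lemma finite_set_conv_pmf [simp]:
  "finite (set_pmf p) \<Longrightarrow> finite (set_pmf q) \<Longrightarrow> finite (set_pmf (conv_pmf p q))"
  by (simp add: conv_pmf_def)

lemma finite_set_iid_sum_pmf [simp]: "finite (set_pmf q) \<Longrightarrow> finite (set_pmf (iid_sum_pmf q n))"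
  by (induction n) simp_all

lemma mean_conv_pmf:
  assumes [simp]: "finite (set_pmf p)" "finite (set_pmf q)"
  shows "measure_pmf.expectation (conv_pmf p q) real =
    measure_pmf.expectation p real + measure_pmf.expectation q real"
proof -
  have "measure_pmf.expectation (conv_pmf p q) real =
      measure_pmf.expectation (pair_pmf p q) (\<lambda>z. real (fst z) + real (snd z))"
    by (simp add: conv_pmf_def case_prod_unfold)
  also have "\<dots> = measure_pmf.expectation p real + measure_pmf.expectation q real"
    by (subst Bochner_Integration.integral_add) (simp_all add: integrable_measure_pmf_finite)
  finally show ?thesis .
qed

lemma variance_conv_pmf:
  assumes [simp]: "finite (set_pmf p)" "finite (set_pmf q)"
  shows "measure_pmf.variance (conv_pmf p q) real =
    measure_pmf.variance p real + measure_pmf.variance q real"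
proof -
  define a c where "a = measure_pmf.expectation p real" and "c = measure_pmf.expectation q real"
  have [simp]: "measure_pmf.expectation p (\<lambda>x. real x - a) = 0"
    by (simp add: a_def integrable_measure_pmf_finite)
  have int: "integrable (pair_pmf p q) f" for f :: "nat \<times> nat \<Rightarrow> real"
    by (simp add: integrable_measure_pmf_finite)
  have "measure_pmf.variance (conv_pmf p q) real =
      measure_pmf.expectation (pair_pmf p q) (\<lambda>z. (real (fst z) + real (snd z) - (a + c))\<^sup>2)"
    unfolding mean_conv_pmf[OF assms] a_def[symmetric] c_def[symmetric]
    by (simp add: conv_pmf_def case_prod_unfold)
  also have "\<dots> = measure_pmf.expectation (pair_pmf p q) (\<lambda>z. (real (fst z) - a)\<^sup>2
      + (real (snd z) - c)\<^sup>2 + 2 * ((real (fst z) - a) * (real (snd z) - c)))"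
    by (rule Bochner_Integration.integral_cong) (auto simp: power2_eq_square algebra_simps)
  also have "\<dots> = measure_pmf.expectation (pair_pmf p q) (\<lambda>z. (real (fst z) - a)\<^sup>2)
      + measure_pmf.expectation (pair_pmf p q) (\<lambda>z. (real (snd z) - c)\<^sup>2)
      + 2 * measure_pmf.expectation (pair_pmf p q) (\<lambda>z. (real (fst z) - a) * (real (snd z) - c))"
    by (simp add: int)
  also have "\<dots> = measure_pmf.variance p real + measure_pmf.variance q real"
    using expectation_mult_pair_pmf[OF assms, of "\<lambda>x. real x - a" "\<lambda>y. real y - c"]
      expectation_pair_pmf_fst[of p q "\<lambda>x. (real x - a)\<^sup>2"]
      expectation_pair_pmf_snd[of p q "\<lambda>x. (real x - c)\<^sup>2"]
    by (simp only:) (simp add: a_def c_def integrable_measure_pmf_finite)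
  finally show ?thesis .
qed

lemma mean_iid_sum_pmf:
  assumes "finite (set_pmf q)"
  shows "measure_pmf.expectation (iid_sum_pmf q n) real = real n * measure_pmf.expectation q real"
  by (induction n) (simp_all add: assms mean_conv_pmf algebra_simps)

lemma variance_iid_sum_pmf:
  assumes "finite (set_pmf q)"
  shows "measure_pmf.variance (iid_sum_pmf q n) real = real n * measure_pmf.variance q real"
proof (induction n)
  case (Suc n)
  then show ?case
    unfolding iid_sum_pmf.simps by (subst variance_conv_pmf) (simp_all add: assms algebra_simps)
qed simp

lemma Chebyshev_iid_sum_pmf:
  assumes fin [simp]: "finite (set_pmf q)" and "0 < a"
  shows "measure_pmf.prob (iid_sum_pmf q m)
      {j. a \<le> \<bar>real j - real m * measure_pmf.expectation q real\<bar>}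
    \<le> real m * measure_pmf.expectation q (\<lambda>n. (real n)\<^sup>2) / a\<^sup>2"
proof -
  have int: "integrable (measure_pmf q) f" "integrable (measure_pmf (iid_sum_pmf q m)) f"
    for f :: "nat \<Rightarrow> real"
    by (simp_all add: integrable_measure_pmf_finite)
  have "measure_pmf.prob (iid_sum_pmf q m)
      {j. a \<le> \<bar>real j - real m * measure_pmf.expectation q real\<bar>}
    \<le> measure_pmf.variance (iid_sum_pmf q m) real / a\<^sup>2"
    using measure_pmf.Chebyshev_inequality[of real "iid_sum_pmf q m" a] assms
    by (simp add: int mean_iid_sum_pmf)
  also have "measure_pmf.variance q real \<le> measure_pmf.expectation q (\<lambda>n. (real n)\<^sup>2)"
    by (subst measure_pmf.variance_eq) (simp_all add: int)
  then have "measure_pmf.variance (iid_sum_pmf q m) real / a\<^sup>2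
      \<le> real m * measure_pmf.expectation q (\<lambda>n. (real n)\<^sup>2) / a\<^sup>2"
    by (subst variance_iid_sum_pmf) (auto intro!: divide_right_mono mult_left_mono)
  finally show ?thesis .
qed

lemma rel_iid_sum_pmf:
  assumes "rel_pmf R q q'" "R 0 0"
    and "\<And>x y x' y'. R x y \<Longrightarrow> R x' y' \<Longrightarrow> R (x + x') (y + y')"
  shows "rel_pmf R (iid_sum_pmf q n) (iid_sum_pmf q' n)"
proof (induction n)
  case (Suc n)
  show ?case
    unfolding iid_sum_pmf.simps conv_pmf_altdef
    by (intro rel_pmf_bindI[OF assms(1)] rel_pmf_bindI[OF Suc]) (simp add: rel_pmf_return_pmf1 assms)
qed (simp add: rel_pmf_return_pmf1 assms)

abbreviation truncate_pmf :: "nat \<Rightarrow> nat pmf \<Rightarrow> nat pmf" where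
  "truncate_pmf k \<equiv> map_pmf (min k)"

lemma finite_set_truncate_pmf [simp]: "finite (set_pmf (truncate_pmf k q))"
  by (rule finite_subset[of _ "{..k}"]) auto

text \<open>A sum of natural numbers is at least \<open>k\<close> iff it is so after truncating the summands at \<open>k\<close>.\<close>

lemma prob_iid_sum_truncate_pmf:
  "measure_pmf.prob (iid_sum_pmf q m) {j. k \<le> j} \<le>
    measure_pmf.prob (iid_sum_pmf (truncate_pmf k q) m) {j. k \<le> j}"
proof -
  let ?R = "\<lambda>x y :: nat. min k x = min k y"
  have "rel_pmf ?R (iid_sum_pmf q m) (iid_sum_pmf (truncate_pmf k q) m)"
    by (rule rel_iid_sum_pmf) (auto simp: pmf.rel_map intro!: rel_pmf_reflI)
  from rel_pmf_measureD[OF this, of "{j. k \<le> j}"] show ?thesis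
    by (rule order.trans) (auto intro!: measure_pmf.finite_measure_mono)
qed

lemma tail_iid_sum_truncate_pmf_le:
  "tail_pmf (iid_sum_pmf (truncate_pmf k q) m) x \<le> tail_pmf (iid_sum_pmf q m) x"
proof -
  have "rel_pmf (\<le>) (iid_sum_pmf (truncate_pmf k q) m) (iid_sum_pmf q m)"
    by (rule rel_iid_sum_pmf) (auto simp: pmf.rel_map intro!: rel_pmf_reflI)
  from rel_pmf_measureD[OF this, of "{j. x < real j}"] show ?thesis
    by (rule order.trans) (auto intro!: measure_pmf.finite_measure_mono)
qed

definition truncated_square :: "nat pmf \<Rightarrow> nat \<Rightarrow> real" where
  "truncated_square q k = measure_pmf.expectation q (\<lambda>n. (real (min k n))\<^sup>2) / (real k)\<^sup>2"

definition partial_mean :: "nat pmf \<Rightarrow> real \<Rightarrow> real" where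
  "partial_mean p y = measure_pmf.expectation p (\<lambda>n. real n * of_bool (real n \<le> y))"

lemma integrable_partial_mean [simp]:
  "integrable (measure_pmf p) (\<lambda>n. real n * of_bool (real n \<le> y))"
  by (rule integrable_measure_pmf_bounded[where C = "\<bar>y\<bar>"]) auto

lemma partial_mean_nonneg: "0 \<le> partial_mean p y"
  unfolding partial_mean_def by (rule integral_nonneg_AE) simp

lemma truncated_square_nonneg: "0 \<le> truncated_square q k"
  unfolding truncated_square_def by (intro divide_nonneg_nonneg integral_nonneg_AE) simp_all

lemma truncated_mean_of_nat:
  "truncated_mean q (real k) = measure_pmf.expectation (truncate_pmf k q) real"
  by (simp add: min.commute of_nat_min)

lemma prob_iid_sum_pmf_le:
  assumes b: "truncated_mean q k \<le> b" and m: "real m * b \<le> (1 - \<delta>) * real k"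
    and "0 < \<delta>" "0 < k"
  shows "measure_pmf.prob (iid_sum_pmf q m) {j. k \<le> j} \<le> real m * (truncated_square q k / \<delta>\<^sup>2)"
proof -
  define \<mu> where "\<mu> = measure_pmf.expectation (truncate_pmf k q) real"
  have "real m * \<mu> \<le> real m * b"
    using b unfolding truncated_mean_of_nat \<mu>_def by (intro mult_left_mono) auto
  with m have \<mu>: "real m * \<mu> \<le> (1 - \<delta>) * real k" by simp
  have "measure_pmf.prob (iid_sum_pmf q m) {j. k \<le> j}
      \<le> measure_pmf.prob (iid_sum_pmf (truncate_pmf k q) m) {j. k \<le> j}"
    by (rule prob_iid_sum_truncate_pmf)
  also have "\<dots> \<le> measure_pmf.prob (iid_sum_pmf (truncate_pmf k q) m)
      {j. \<delta> * real k \<le> \<bar>real j - real m * \<mu>\<bar>}"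
  proof (rule measure_pmf.finite_measure_mono)
    show "{j. k \<le> j} \<subseteq> {j. \<delta> * real k \<le> \<bar>real j - real m * \<mu>\<bar>}"
    proof safe
      fix j assume "k \<le> j"
      then have "real k \<le> real j" by simp
      with \<mu> show "\<delta> * real k \<le> \<bar>real j - real m * \<mu>\<bar>" by (simp add: algebra_simps)
    qed
  qed simp
  also have "\<dots> \<le> real m * measure_pmf.expectation (truncate_pmf k q) (\<lambda>n. (real n)\<^sup>2)
      / (\<delta> * real k)\<^sup>2"
    unfolding \<mu>_def by (rule Chebyshev_iid_sum_pmf[OF finite_set_truncate_pmf]) (use assms in simp)
  also have "\<dots> = real m * (truncated_square q k / \<delta>\<^sup>2)"
    by (simp add: truncated_square_def power_mult_distrib mult.commute)
  finally show ?thesis .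
qed

lemma tail_random_sum_pmf_le:
  assumes b: "\<And>K. truncated_mean q K \<le> b" and "b < \<rho>" "0 \<le> x"
  shows "tail_pmf (random_sum_pmf p q) x \<le> tail_pmf p (x / \<rho>)
    + partial_mean p (x / \<rho>) * (truncated_square q (nat \<lfloor>x\<rfloor> + 1) / (1 - b / \<rho>)\<^sup>2)"
proof -
  define k where "k = nat \<lfloor>x\<rfloor> + 1"
  define c where "c = truncated_square q k / (1 - b / \<rho>)\<^sup>2"
  have "0 \<le> b" using b[of 0] by simp
  then have \<rho>: "0 < \<rho>" "0 < 1 - b / \<rho>" using assms by auto
  have c: "0 \<le> c" unfolding c_def by (simp add: truncated_square_nonneg)
  have k: "x \<le> real k" "0 < k" "{n. x < real n} = {j. k \<le> j}"
    using \<open>0 \<le> x\<close> unfolding k_def by (auto; linarith)+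
  have pointwise: "tail_pmf (iid_sum_pmf q m) x
      \<le> indicator {n. x / \<rho> < real n} m + real m * of_bool (real m \<le> x / \<rho>) * c" for m
  proof (cases "real m \<le> x / \<rho>")
    case True
    then have "real m * b \<le> x / \<rho> * b" using \<open>0 \<le> b\<close> by (rule mult_right_mono)
    also have "\<dots> \<le> b / \<rho> * real k"
      using k(1) \<rho> \<open>0 \<le> b\<close> by (simp add: divide_right_mono mult.commute mult_left_mono)
    finally have "real m * b \<le> (1 - (1 - b / \<rho>)) * real k" by simp
    from prob_iid_sum_pmf_le[OF b this \<rho>(2) k(2)] True show ?thesis
      by (simp add: k(3) c_def)
  qed (use c in \<open>simp add: not_le\<close>)
  have int: "integrable (measure_pmf p) (indicator {n. x / \<rho> < real n} :: nat \<Rightarrow> real)"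
    by (rule integrable_measure_pmf_bounded[where C = 1]) (simp add: indicator_def)
  have "tail_pmf (random_sum_pmf p q) x
      = measure_pmf.expectation p (\<lambda>m. tail_pmf (iid_sum_pmf q m) x)"
    unfolding random_sum_pmf_def by (rule prob_bind_pmf)
  also have "\<dots> \<le> measure_pmf.expectation p (\<lambda>m. indicator {n. x / \<rho> < real n} m
      + real m * of_bool (real m \<le> x / \<rho>) * c)"
    by (intro integral_mono pointwise Bochner_Integration.integrable_add int
        integrable_mult_left integrable_partial_mean
        integrable_measure_pmf_bounded[where C = 1]) simp
  also have "\<dots> = tail_pmf p (x / \<rho>) + partial_mean p (x / \<rho>) * c"
    by (subst Bochner_Integration.integral_add) (simp_all add: int partial_mean_def)
  finally show ?thesis by (simp add: c_def k_def)
qed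

lemma tail_iid_sum_pmf_ge:
  assumes c: "c < truncated_mean q (real k)" and "0 < m"
  shows "1 - (real k)\<^sup>2 / ((truncated_mean q (real k) - c)\<^sup>2 * real m)
    \<le> tail_pmf (iid_sum_pmf q m) (c * real m)"
proof -
  define \<mu> where "\<mu> = measure_pmf.expectation (truncate_pmf k q) real"
  let ?P = "iid_sum_pmf (truncate_pmf k q) m"
  let ?S = "{j. (\<mu> - c) * real m \<le> \<bar>real j - real m * \<mu>\<bar>}"
  have \<mu>: "truncated_mean q (real k) = \<mu>" by (simp add: \<mu>_def truncated_mean_of_nat)
  have d: "0 < \<mu> - c" using c \<mu> by simp
  have "measure_pmf.prob ?P ?S
     \<le> real m * measure_pmf.expectation (truncate_pmf k q) (\<lambda>n. (real n)\<^sup>2) / ((\<mu> - c) * real m)\<^sup>2"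
    unfolding \<mu>_def by (rule Chebyshev_iid_sum_pmf[OF finite_set_truncate_pmf])
      (use d \<open>0 < m\<close> in \<open>simp add: \<mu>_def\<close>)
  also have "\<dots> \<le> real m * (real k)\<^sup>2 / ((\<mu> - c) * real m)\<^sup>2"
    by (intro divide_right_mono mult_left_mono measure_pmf.integral_le_const)
       (auto simp: power_mono simp del: integrable_map_pmf_eq
         intro!: AE_pmfI integrable_measure_pmf_finite[OF finite_set_truncate_pmf])
  also have "\<dots> = (real k)\<^sup>2 / ((\<mu> - c)\<^sup>2 * real m)"
    using \<open>0 < m\<close> by (simp add: power2_eq_square)
  finally have "1 - (real k)\<^sup>2 / ((\<mu> - c)\<^sup>2 * real m) \<le> 1 - measure_pmf.prob ?P ?S" by simp
  also have "\<dots> = measure_pmf.prob ?P (- ?S)"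
    by (subst measure_pmf.prob_compl[symmetric]) (simp_all add: Compl_eq_Diff_UNIV)
  also have "\<dots> \<le> tail_pmf ?P (c * real m)"
    by (rule measure_pmf.finite_measure_mono) (auto simp: algebra_simps abs_if split: if_splits)
  also have "\<dots> \<le> tail_pmf (iid_sum_pmf q m) (c * real m)"
    by (rule tail_iid_sum_truncate_pmf_le)
  finally show ?thesis by (simp add: \<mu>)
qed

lemma tail_random_sum_pmf_ge:
  assumes c: "0 < c" "c < truncated_mean q (real k)" and \<eta>: "0 < \<eta>"
  shows "\<exists>x0. \<forall>x\<ge>x0. \<forall>p. (1 - \<eta>) * tail_pmf p (x / c) \<le> tail_pmf (random_sum_pmf p q) x"
proof -
  define C where "C = (real k)\<^sup>2 / (truncated_mean q (real k) - c)\<^sup>2"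
  define x0 where "x0 = c * (C / \<eta>)"
  have "0 \<le> C" by (simp add: C_def)
  have "(1 - \<eta>) * tail_pmf p (x / c) \<le> tail_pmf (random_sum_pmf p q) x" if x: "x0 \<le> x" for x p
  proof -
    have pointwise: "(1 - \<eta>) * indicator {n. x / c < real n} m \<le> tail_pmf (iid_sum_pmf q m) x" for m
    proof (cases "x / c < real m")
      case True
      have "C / \<eta> \<le> x / c" using x c by (simp add: x0_def field_simps)
      with True have m: "C / \<eta> < real m" by simp
      then have "0 < m" using \<open>0 \<le> C\<close> \<eta> by (cases m) (auto simp: divide_less_0_iff)
      have "1 - \<eta> \<le> 1 - C / real m" using m \<eta> \<open>0 < m\<close> by (simp add: field_simps)
      also have "\<dots> \<le> tail_pmf (iid_sum_pmf q m) (c * real m)"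
        using tail_iid_sum_pmf_ge[OF c(2) \<open>0 < m\<close>] by (simp add: C_def)
      also have "\<dots> \<le> tail_pmf (iid_sum_pmf q m) x"
        using True c by (intro measure_pmf.finite_measure_mono) (auto simp: field_simps)
      finally show ?thesis using True by simp
    qed simp
    have int: "integrable (measure_pmf p) (indicator {n. x / c < real n} :: nat \<Rightarrow> real)"
      by (rule integrable_measure_pmf_bounded[where C = 1]) (simp add: indicator_def)
    have "(1 - \<eta>) * tail_pmf p (x / c)
        = measure_pmf.expectation p (\<lambda>m. (1 - \<eta>) * indicator {n. x / c < real n} m)"
      by simp
    also have "\<dots> \<le> measure_pmf.expectation p (\<lambda>m. tail_pmf (iid_sum_pmf q m) x)"
      by (intro integral_mono pointwise integrable_mult_right int
          integrable_measure_pmf_bounded[where C = 1]) simp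
    also have "\<dots> = tail_pmf (random_sum_pmf p q) x"
      unfolding random_sum_pmf_def by (rule prob_bind_pmf[symmetric])
    finally show ?thesis .
  qed
  then show ?thesis by blast
qed

section \<open>Truncated moments from tails\<close>

lemma min_of_nat_eq_sum: "min (real n) (real k) = (\<Sum>j<k. of_bool (j < n))"
proof (induction k)
  case (Suc k)
  then show ?case by (cases "k < n") (simp_all add: min_def)
qed simp

lemma min_of_nat_square_eq_sum:
  "(real (min k n))\<^sup>2 = (\<Sum>j<k. (2 * real j + 1) * of_bool (j < n))"
proof (induction k)
  case (Suc k)
  show ?case
  proof (cases "k < n")
    case True
    then show ?thesis using Suc by (simp add: min_def power2_eq_square algebra_simps)
  next
    case False
    then show ?thesis using Suc by (simp add: min_absorb2)
  qed
qed simp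

lemma integrable_of_bool [simp]: "integrable (measure_pmf p) (\<lambda>n. of_bool (P n) :: real)"
  by (rule integrable_measure_pmf_bounded[where C = 1]) simp

lemma expectation_of_bool_less:
  "measure_pmf.expectation p (\<lambda>n. of_bool (j < n)) = tail_pmf p (real j)"
proof -
  have "(\<lambda>n. of_bool (j < n)) = (indicator {n. real j < real n} :: nat \<Rightarrow> real)"
    by (auto simp: fun_eq_iff indicator_def)
  then show ?thesis by simp
qed

lemma truncated_mean_eq_sum: "truncated_mean p (real k) = (\<Sum>j<k. tail_pmf p (real j))"
  unfolding min_of_nat_eq_sum
  by (subst Bochner_Integration.integral_sum) (simp_all only: integrable_of_bool expectation_of_bool_less)

lemma truncated_square_eq_sum:
  "truncated_square p k = (\<Sum>j<k. (2 * real j + 1) * tail_pmf p (real j)) / (real k)\<^sup>2"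
  unfolding truncated_square_def min_of_nat_square_eq_sum
  by (subst Bochner_Integration.integral_sum)
     (simp_all only: integrable_of_bool integral_mult_right_zero integrable_mult_right
       expectation_of_bool_less)

lemma truncated_mean_mono: "K \<le> K' \<Longrightarrow> truncated_mean p K \<le> truncated_mean p K'"
  by (intro integral_mono) auto

lemma tail_pmf_antimono: "x \<le> y \<Longrightarrow> tail_pmf p y \<le> tail_pmf p x"
  by (intro measure_pmf.finite_measure_mono) auto

lemma tail_pmf_tendsto_0: "((\<lambda>x. tail_pmf p x) \<longlongrightarrow> 0) at_top"
proof -
  have "(\<lambda>k. measure_pmf.prob p {n. real k < real n}) \<longlonglongrightarrow> measure_pmf.prob p (\<Inter>k. {n. real k < real n})"
    by (rule measure_pmf.finite_Lim_measure_decseq) (auto simp: decseq_def)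
  moreover have "(\<Inter>k. {n. real k < real n}) = {}" by auto
  ultimately have lim: "(\<lambda>k. tail_pmf p (real k)) \<longlonglongrightarrow> 0" by simp
  have "((\<lambda>x. tail_pmf p (real (nat \<lfloor>x\<rfloor>))) \<longlongrightarrow> 0) at_top"
    by (rule filterlim_compose[OF lim])
      (rule filterlim_compose[OF filterlim_nat_sequentially filterlim_floor_sequentially])
  then show ?thesis
  proof (rule tendsto_sandwich[OF _ _ tendsto_const, rotated 2])
    show "\<forall>\<^sub>F x in at_top. tail_pmf p x \<le> tail_pmf p (real (nat \<lfloor>x\<rfloor>))"
      using eventually_ge_at_top[of 0] by eventually_elim (rule tail_pmf_antimono, simp)
  qed simp
qed

lemma truncated_mean_log_bound:
  assumes "((\<lambda>x. x * tail_pmf p x) \<longlongrightarrow> c) at_top"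
  obtains C where "0 \<le> C" "\<And>K. 1 \<le> K \<Longrightarrow> truncated_mean p K \<le> C * (2 + ln K)"
proof -
  define C0 where "C0 = \<bar>c\<bar> + 1"
  have C0: "0 < C0" and c0: "c < C0" unfolding C0_def by linarith+
  obtain N where N: "\<And>x. N \<le> x \<Longrightarrow> x * tail_pmf p x < C0"
    using order_tendstoD(2)[OF assms, of C0] c0 unfolding eventually_at_top_linorder by blast
  define C where "C = C0 + \<bar>N\<bar> + 1"
  have C: "tail_pmf p (real j) \<le> C * inverse (real (Suc j))" for j
  proof -
    have "(1 + real j) * tail_pmf p (real j) \<le> C"
    proof (cases "N \<le> real j")
      case True
      have "real j * tail_pmf p (real j) < C0" using N[OF True] .
      then show ?thesis
        using measure_pmf.prob_le_1[of p "{n. real j < real n}"]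
        unfolding C_def distrib_right mult_1 by linarith
    next
      case False
      have "(1 + real j) * tail_pmf p (real j) \<le> (1 + real j) * 1"
        by (intro mult_left_mono) auto
      also have "\<dots> \<le> C" using False C0 by (simp add: C_def)
      finally show ?thesis .
    qed
    then show ?thesis by (simp add: field_simps)
  qed
  have "truncated_mean p K \<le> C * (2 + ln K)" if K: "1 \<le> K" for K
  proof -
    define k where "k = nat \<lceil>K\<rceil>"
    have k: "K \<le> real k" "real k \<le> 2 * K" "0 < k" using K unfolding k_def by linarith+
    have "truncated_mean p K \<le> truncated_mean p (real k)" by (rule truncated_mean_mono[OF k(1)])
    also have "\<dots> \<le> (\<Sum>j<k. C * inverse (real (Suc j)))"
      unfolding truncated_mean_eq_sum by (intro sum_mono C)
    also have "\<dots> = C * harm k" by (simp add: harm_altdef sum_distrib_left)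
    also have "\<dots> \<le> C * (1 + ln (real k))"
    proof (rule mult_left_mono)
      have "harm 1 = (1 :: real)" by (simp add: harm_expand)
      then show "harm k \<le> 1 + ln (real k)"
        using euler_mascheroni_sequence_decreasing[of 1 k] k(3) by simp
    qed (use C0 in \<open>simp add: C_def\<close>)
    also have "\<dots> \<le> C * (2 + ln K)"
    proof -
      have "ln (real k) \<le> ln (2 * K)" using k K by simp
      also have "\<dots> \<le> 1 + ln K" using K ln_2_less_1 by (simp add: ln_mult)
      finally show ?thesis using C0 by (intro mult_left_mono) (auto simp: C_def)
    qed
    finally show ?thesis .
  qed
  then show ?thesis using that[of C] C0 by (simp add: C_def)
qed

text \<open>
  In \<open>truncated_square_eq_sum\<close>, the indices \<open>j \<le> sqrt k\<close> are negligible, and for the others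
  \<open>ln j \<ge> ln k / 2\<close>.
\<close>

lemma truncated_square_tendsto_0:
  assumes "((\<lambda>x. x * ln x * tail_pmf q x) \<longlongrightarrow> 0) at_top"
  shows "(\<lambda>k. real k * ln (real k) * truncated_square q k) \<longlonglongrightarrow> 0"
proof -
  define t where "t = (\<lambda>j. (2 * real j + 1) * tail_pmf q (real j))"
  have t0: "0 \<le> t j" for j by (simp add: t_def)
  have lim: "(\<lambda>j. real j * ln (real j) * tail_pmf q (real j)) \<longlonglongrightarrow> 0"
    by (rule filterlim_compose[OF assms filterlim_real_sequentially])
  have "(\<lambda>j. 3 * (real j * ln (real j) * tail_pmf q (real j))) \<longlonglongrightarrow> 0"
    using tendsto_mult_right_zero[OF lim, of 3] .
  then have tln: "(\<lambda>j. t j * ln (real j)) \<longlonglongrightarrow> 0"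
  proof (rule tendsto_sandwich[OF _ _ tendsto_const, rotated 2])
    show "\<forall>\<^sub>F j in sequentially. t j * ln (real j) \<le> 3 * (real j * ln (real j) * tail_pmf q (real j))"
      using eventually_ge_at_top[of 1]
    proof eventually_elim
      case (elim j)
      then have "(2 * real j + 1) * (tail_pmf q (real j) * ln (real j))
          \<le> (3 * real j) * (tail_pmf q (real j) * ln (real j))"
        by (intro mult_right_mono mult_nonneg_nonneg) auto
      then show ?case by (simp add: t_def mult_ac)
    qed
    show "\<forall>\<^sub>F j in sequentially. 0 \<le> t j * ln (real j)"
      using eventually_ge_at_top[of 1] by eventually_elim (simp add: t0)
  qed
  have "\<forall>\<^sub>F j in sequentially. t j \<le> 1"
    using order_tendstoD(2)[OF tln zero_less_one] eventually_ge_at_top[of 3]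
  proof eventually_elim
    case (elim j)
    have "exp 1 \<le> (3 :: real)" using exp_le by simp
    then have "1 \<le> ln (real j)" using elim by (subst ln_ge_iff) auto
    then have "t j * 1 \<le> t j * ln (real j)" by (intro mult_left_mono t0)
    then show ?case using elim by simp
  qed
  then have "Bseq t" by (intro BfunI[where K = 1]) (simp add: t0)
  then obtain T where T: "0 < T" "\<And>j. t j \<le> T" using t0 by (auto simp: Bseq_def)
  have bound: "\<forall>\<^sub>F k in sequentially. real k * ln (real k) * truncated_square q k
     \<le> 2 * \<eta> + T * ((sqrt (real k) + 1) * ln (real k) / real k)" if \<eta>: "0 < \<eta>" for \<eta>
  proof -
    obtain N where N: "\<And>j. N \<le> j \<Longrightarrow> t j * ln (real j) < \<eta>"
      using order_tendstoD(2)[OF tln \<eta>] by (auto simp: eventually_sequentially)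
    have "\<forall>\<^sub>F k in sequentially. real N \<le> sqrt (real k)"
      by (rule filterlim_at_top[THEN iffD1, rule_format])
         (intro filterlim_compose[OF sqrt_at_top filterlim_real_sequentially])
    then show ?thesis using eventually_ge_at_top[of 2]
    proof eventually_elim
      case (elim k)
      have lnk: "0 < ln (real k)" using elim by simp
      have pointwise: "t j \<le> 2 * \<eta> / ln (real k) + T * of_bool (real j \<le> sqrt (real k))" for j
      proof (cases "real j \<le> sqrt (real k)")
        case True
        then show ?thesis using T(2)[of j] \<eta> lnk by (simp add: add_increasing)
      next
        case False
        then have "N \<le> j" using elim by linarith
        have "1 < sqrt (real k)" using elim by simp
        have "ln (real k) / 2 = ln (sqrt (real k))" using elim by (simp add: ln_sqrt)
        also have "\<dots> \<le> ln (real j)" using False \<open>1 < sqrt (real k)\<close>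
          by (subst ln_le_cancel_iff) linarith+
        finally have "t j * (ln (real k) / 2) \<le> t j * ln (real j)" by (intro mult_left_mono t0)
        also have "\<dots> < \<eta>" by (rule N) fact
        finally show ?thesis using False lnk by (simp add: field_simps)
      qed
      have "(\<Sum>j<k. t j) \<le> (\<Sum>j<k. 2 * \<eta> / ln (real k) + T * of_bool (real j \<le> sqrt (real k)))"
        by (intro sum_mono pointwise)
      also have "\<dots> = real k * (2 * \<eta> / ln (real k)) + T * (\<Sum>j<k. of_bool (real j \<le> sqrt (real k)))"
        by (simp add: sum.distrib sum_distrib_left)
      also have "(\<Sum>j<k. of_bool (real j \<le> sqrt (real k))) = real (card {j\<in>{..<k}. real j \<le> sqrt (real k)})"
        by (simp add: of_bool_def sum.If_cases Int_def)
      also have "\<dots> \<le> real (card {..nat \<lfloor>sqrt (real k)\<rfloor>})"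
        by (intro of_nat_mono card_mono) (auto simp: le_nat_iff le_floor_iff)
      also have "\<dots> \<le> sqrt (real k) + 1" by simp
      finally have "(\<Sum>j<k. t j) \<le> real k * (2 * \<eta> / ln (real k)) + T * (sqrt (real k) + 1)"
        using T by simp
      then have "(\<Sum>j<k. t j) * (ln (real k) / real k)
          \<le> (real k * (2 * \<eta> / ln (real k)) + T * (sqrt (real k) + 1)) * (ln (real k) / real k)"
        using lnk by (intro mult_right_mono) auto
      also have "\<dots> = 2 * \<eta> + T * ((sqrt (real k) + 1) * ln (real k) / real k)"
        using lnk elim by (simp add: field_simps)
      finally show ?case
        using elim by (simp add: truncated_square_eq_sum t_def power2_eq_square mult_ac)
    qed
  qed
  have vanish: "(\<lambda>k. T * ((sqrt (real k) + 1) * ln (real k) / real k)) \<longlonglongrightarrow> 0"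
    by (rule tendsto_mult_right_zero) real_asymp
  show ?thesis
  proof (rule order_tendstoI)
    fix y :: real assume y: "y < 0"
    show "\<forall>\<^sub>F k in sequentially. y < real k * ln (real k) * truncated_square q k"
      using eventually_ge_at_top[of 1]
    proof eventually_elim
      case (elim k)
      then have "0 \<le> real k * ln (real k) * truncated_square q k"
        by (intro mult_nonneg_nonneg) (auto simp: truncated_square_nonneg)
      then show ?case using y by simp
    qed
  next
    fix y :: real assume y: "0 < y"
    then have "\<forall>\<^sub>F k in sequentially. T * ((sqrt (real k) + 1) * ln (real k) / real k) < y / 2"
      by (intro order_tendstoD(2)[OF vanish]) simp
    moreover have "\<forall>\<^sub>F k in sequentially. real k * ln (real k) * truncated_square q k
        \<le> 2 * (y / 4) + T * ((sqrt (real k) + 1) * ln (real k) / real k)"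
      by (rule bound) (use y in simp)
    ultimately show "\<forall>\<^sub>F k in sequentially. real k * ln (real k) * truncated_square q k < y"
      by eventually_elim linarith
  qed
qed

lemma truncated_square_floor_tendsto_0:
  assumes "((\<lambda>x. x * ln x * tail_pmf q x) \<longlongrightarrow> 0) at_top"
  shows "((\<lambda>x. x * ln x * truncated_square q (nat \<lfloor>x\<rfloor> + 1)) \<longlongrightarrow> 0) at_top"
proof -
  let ?k = "\<lambda>x. nat \<lfloor>x\<rfloor> + 1"
  have k: "filterlim ?k at_top at_top"
    by (rule filterlim_at_top_mono[OF filterlim_compose[OF filterlim_nat_sequentially
          filterlim_floor_sequentially]]) simp
  have "((\<lambda>x. real (?k x) * ln (real (?k x)) * truncated_square q (?k x)) \<longlongrightarrow> 0) at_top"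
    by (rule filterlim_compose[OF truncated_square_tendsto_0[OF assms] k])
  then show ?thesis
  proof (rule tendsto_sandwich[OF _ _ tendsto_const, rotated 2])
    show "\<forall>\<^sub>F x in at_top. x * ln x * truncated_square q (?k x)
        \<le> real (?k x) * ln (real (?k x)) * truncated_square q (?k x)"
      using eventually_ge_at_top[of 1]
    proof eventually_elim
      case (elim x)
      have "x \<le> real (?k x)" using elim by linarith
      then show ?case
        using elim by (intro mult_right_mono mult_mono truncated_square_nonneg) auto
    qed
    show "\<forall>\<^sub>F x in at_top. 0 \<le> x * ln x * truncated_square q (?k x)"
      using eventually_ge_at_top[of 1]
      by eventually_elim (simp add: truncated_square_nonneg)
  qed
qed

section \<open>The fixed point\<close>

lemma partial_mean_le_truncated_mean: "0 \<le> y \<Longrightarrow> partial_mean p y \<le> truncated_mean p y"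
  unfolding partial_mean_def by (intro integral_mono) auto

lemma recursive_upper_bound:
  fixes f :: "real \<Rightarrow> real"
  assumes f: "(f \<longlongrightarrow> 0) at_top" and x0: "0 < x0" and \<rho>: "0 < \<rho>" "\<rho> < 1" and c: "0 \<le> c"
    and step: "\<And>x. x0 \<le> x \<Longrightarrow> f x \<le> c / x + f (x / \<rho>)"
    and x: "x0 \<le> x"
  shows "f x \<le> c / (1 - \<rho>) / x"
proof -
  have grow: "x \<le> x / \<rho> ^ n" for n
    using x x0 \<rho> power_le_one[of \<rho> n] by (simp add: field_simps mult_left_le)
  have iter: "f x \<le> c / x * (\<Sum>k<n. \<rho> ^ k) + f (x / \<rho> ^ n)" for n
  proof (induction n)
    case (Suc n)
    have "f (x / \<rho> ^ n) \<le> c / (x / \<rho> ^ n) + f (x / \<rho> ^ n / \<rho>)"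
      by (rule step) (use grow[of n] x in linarith)
    with Suc show ?case by (simp add: algebra_simps)
  qed simp
  have "filterlim (\<lambda>n. x * inverse \<rho> ^ n) at_top sequentially"
    using x x0 \<rho>
    by (intro filterlim_tendsto_pos_mult_at_top[OF tendsto_const]
        filterlim_at_infinity_imp_filterlim_at_top[OF filterlim_realpow_sequentially_gt1])
       (auto simp: one_less_inverse_iff)
  then have "(\<lambda>n. f (x * inverse \<rho> ^ n)) \<longlonglongrightarrow> 0" by (rule filterlim_compose[OF f])
  then have tail: "(\<lambda>n. f (x / \<rho> ^ n)) \<longlonglongrightarrow> 0"
    by (simp add: divide_inverse power_inverse)
  have geom: "(\<lambda>n. \<Sum>k<n. \<rho> ^ k) \<longlonglongrightarrow> 1 / (1 - \<rho>)"
    using geometric_sums[of \<rho>] \<rho> by (simp add: sums_def)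
  have "(\<lambda>n. c / x * (\<Sum>k<n. \<rho> ^ k) + f (x / \<rho> ^ n)) \<longlonglongrightarrow> c / x * (1 / (1 - \<rho>)) + 0"
    by (intro tendsto_intros geom tail)
  from LIMSEQ_le_const[OF this] have "f x \<le> c / x * (1 / (1 - \<rho>)) + 0" using iter by blast
  then show ?thesis by (simp add: mult.commute)
qed

lemma recursive_lower_bound:
  fixes f :: "real \<Rightarrow> real"
  assumes f: "\<And>x. 0 \<le> f x" and x0: "0 < x0" and \<rho>: "0 < \<rho>" "\<rho> < 1"
    and a: "0 \<le> a" "a \<le> 1" and c: "0 \<le> c"
    and step: "\<And>x. x0 \<le> x \<Longrightarrow> c / x + a * f (x / \<rho>) \<le> f x"
    and x: "x0 \<le> x"
  shows "c / (1 - a * \<rho>) / x \<le> f x"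
proof -
  have grow: "x \<le> x / \<rho> ^ n" for n
    using x x0 \<rho> power_le_one[of \<rho> n] by (simp add: field_simps mult_left_le)
  have iter: "c / x * (\<Sum>k<n. (a * \<rho>) ^ k) + a ^ n * f (x / \<rho> ^ n) \<le> f x" for n
  proof (induction n)
    case (Suc n)
    have "c / (x / \<rho> ^ n) + a * f (x / \<rho> ^ n / \<rho>) \<le> f (x / \<rho> ^ n)"
      by (rule step) (use grow[of n] x in linarith)
    then have "a ^ n * (c / (x / \<rho> ^ n) + a * f (x / \<rho> ^ n / \<rho>)) \<le> a ^ n * f (x / \<rho> ^ n)"
      using a by (intro mult_left_mono) auto
    with Suc show ?case by (simp add: algebra_simps power_mult_distrib)
  qed simp
  have "norm (a * \<rho>) < 1"

  proof -
    have "a * \<rho> \<le> 1 * \<rho>" by (rule mult_right_mono) (use a \<rho> in auto)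
    then have "a * \<rho> < 1" using \<rho> by linarith
    then show ?thesis using a \<rho> by (simp add: abs_mult)
  qed
  then have geom: "(\<lambda>n. \<Sum>k<n. (a * \<rho>) ^ k) \<longlonglongrightarrow> 1 / (1 - a * \<rho>)"
    using geometric_sums[of "a * \<rho>"] by (simp add: sums_def)
  have "(\<lambda>n. c / x * (\<Sum>k<n. (a * \<rho>) ^ k)) \<longlonglongrightarrow> c / x * (1 / (1 - a * \<rho>))"
    by (intro tendsto_intros geom)
  moreover have "c / x * (\<Sum>k<n. (a * \<rho>) ^ k) \<le> f x" for n
    using iter[of n] f[of "x / \<rho> ^ n"] a by (smt (verit) mult_nonneg_nonneg zero_le_power)
  ultimately have "c / x * (1 / (1 - a * \<rho>)) \<le> f x"
    by (intro LIMSEQ_le_const2) auto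
  then show ?thesis by (simp add: mult.commute)
qed

lemma tendsto_scaled_tail:
  assumes "((\<lambda>x. x * f x) \<longlongrightarrow> l) at_top" "0 < (a :: real)"
  shows "((\<lambda>x. x * f (a * x)) \<longlongrightarrow> l / a) at_top"
proof -
  have "filterlim (\<lambda>x. a * x) at_top at_top"
    by (rule filterlim_tendsto_pos_mult_at_top[OF tendsto_const assms(2) filterlim_ident])
  then have "((\<lambda>x. (a * x) * f (a * x)) \<longlongrightarrow> l) at_top"
    by (rule filterlim_compose[OF assms(1)])
  then have "((\<lambda>x. (a * x) * f (a * x) / a) \<longlongrightarrow> l / a) at_top"
    by (intro tendsto_intros) (use assms in auto)
  then show ?thesis using assms(2) by simp
qed

locale branching_tail =
  fixes p q :: "nat pmf" and b :: real
  assumes tail_p: "((\<lambda>x. x * tail_pmf p x) \<longlongrightarrow> 1) at_top"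
    and tail_q: "((\<lambda>x. x * ln x * tail_pmf q x) \<longlongrightarrow> 0) at_top"
    and int_q: "integrable (measure_pmf q) real"
    and mean_q: "measure_pmf.expectation q real = b"
    and b: "0 < b" "b < 1"
begin

lemma truncated_mean_q_le: "truncated_mean q K \<le> b"
  unfolding mean_q[symmetric] by (intro integral_mono int_q) auto

lemma truncated_mean_q_tendsto: "(\<lambda>k. truncated_mean q (real k)) \<longlonglongrightarrow> b"
  unfolding mean_q[symmetric]
proof (rule integral_dominated_convergence[OF _ _ int_q])
  show "AE n in measure_pmf q. (\<lambda>k. min (real n) (real k)) \<longlonglongrightarrow> real n"
  proof (intro AE_pmfI tendsto_eventually)
    fix n
    show "\<forall>\<^sub>F k in sequentially. min (real n) (real k) = real n"
      using eventually_ge_at_top[of n] by eventually_elim simp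
  qed
qed auto

lemma truncated_mean_q_gt:
  assumes "c < b" obtains k where "c < truncated_mean q (real k)"
  using order_tendstoD(1)[OF truncated_mean_q_tendsto assms] by (auto simp: eventually_sequentially)

lemma tail_step_le:
  assumes "b < \<rho>" "0 < \<eta>"
  obtains x0 where "1 \<le> x0"
    "\<And>x M r. x0 \<le> x \<Longrightarrow> 0 \<le> M \<Longrightarrow> partial_mean r (x / \<rho>) \<le> M * ln x \<Longrightarrow>
      tail_pmf (random_sum_pmf r q) x \<le> tail_pmf r (x / \<rho>) + M * \<eta> / x"
proof -
  define d where "d = (1 - b / \<rho>)\<^sup>2"
  have d: "0 < d" using assms b by (simp add: d_def)
  have "\<forall>\<^sub>F x in at_top. x * ln x * truncated_square q (nat \<lfloor>x\<rfloor> + 1) < \<eta> * d"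
    by (rule order_tendstoD(2)[OF truncated_square_floor_tendsto_0[OF tail_q]]) (simp add: assms d)
  then obtain x1 where x1: "\<And>x. x1 \<le> x \<Longrightarrow> x * ln x * truncated_square q (nat \<lfloor>x\<rfloor> + 1) < \<eta> * d"
    unfolding eventually_at_top_linorder by blast
  show thesis
  proof (rule that[of "max 2 x1"])
    fix x M :: real and r
    assume x: "max 2 x1 \<le> x" and M: "0 \<le> M" and r: "partial_mean r (x / \<rho>) \<le> M * ln x"
    define w where "w = truncated_square q (nat \<lfloor>x\<rfloor> + 1)"
    have lnx: "0 < ln x" using x by simp
    have "x * ln x * w < \<eta> * d" using x1[of x] x by (simp add: w_def)
    then have "ln x * (w / d) \<le> \<eta> / x" using x d by (simp add: field_simps)
    have "partial_mean r (x / \<rho>) * (w / d) \<le> (M * ln x) * (w / d)"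
      using d by (intro mult_right_mono r) (simp add: w_def truncated_square_nonneg)
    also have "\<dots> = M * (ln x * (w / d))" by simp
    also have "\<dots> \<le> M * (\<eta> / x)" by (rule mult_left_mono) fact+
    finally show "tail_pmf (random_sum_pmf r q) x \<le> tail_pmf r (x / \<rho>) + M * \<eta> / x"
      using tail_random_sum_pmf_le[OF truncated_mean_q_le assms(1), of x r] x
      by (simp add: w_def d_def)
  qed simp
qed

lemma tail_step_ge:
  assumes "0 < c" "c < b" "0 < \<eta>"
  obtains x0 where
    "\<And>x r. x0 \<le> x \<Longrightarrow> (1 - \<eta>) * tail_pmf r (x / c) \<le> tail_pmf (random_sum_pmf r q) x"
proof -
  obtain k where "c < truncated_mean q (real k)" using truncated_mean_q_gt[OF assms(2)] .
  from tail_random_sum_pmf_ge[OF assms(1) this assms(3)] show thesis using that by blast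
qed

text \<open>
  Comparing the means of both sides truncated at \<open>K\<close> controls the truncated mean of the fixed
  point, without any a priori integrability.
\<close>

lemma fixed_point_partial_mean_le:
  assumes X: "r = conv_pmf p (random_sum_pmf r q)" and "0 \<le> K"
  shows "(1 - b) * partial_mean r K \<le> truncated_mean p K"
proof -
  let ?E = "measure_pmf.expectation r"
  have int: "integrable (measure_pmf r) (\<lambda>n. min (b * real n) K)"
    using b \<open>0 \<le> K\<close> by (intro integrable_measure_pmf_bounded[where C = K]) auto
  have "truncated_mean r K \<le> truncated_mean p K + truncated_mean (random_sum_pmf r q) K"
    by (subst (1) X) (rule truncated_mean_conv_pmf_le[OF assms(2)])
  also have "truncated_mean (random_sum_pmf r q) K \<le> ?E (\<lambda>n. min (b * real n) K)"
    by (rule truncated_mean_random_sum_pmf_le[OF assms(2) truncated_mean_q_le])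
  finally have "?E (\<lambda>n. min (real n) K - min (b * real n) K) \<le> truncated_mean p K"
    by (subst Bochner_Integration.integral_diff) (simp_all add: int)
  moreover have "(1 - b) * partial_mean r K \<le> ?E (\<lambda>n. min (real n) K - min (b * real n) K)"
    unfolding partial_mean_def integral_mult_right_zero[symmetric]
  proof (rule integral_mono)
    fix n
    have "b * real n \<le> 1 * real n" using b by (intro mult_right_mono) auto
    then show "(1 - b) * (real n * of_bool (real n \<le> K)) \<le> min (real n) K - min (b * real n) K"
      by (auto simp: algebra_simps min_def)
  qed (auto intro: int)
  ultimately show ?thesis by linarith
qed

lemma log_scaled_bound:
  fixes a x :: real
  assumes "1 \<le> ln x" "0 < a" "0 < x"
  shows "2 + ln (x / a) \<le> (3 + \<bar>ln a\<bar>) * ln x"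
proof -
  have "\<bar>ln a\<bar> * 1 \<le> \<bar>ln a\<bar> * ln x" by (rule mult_left_mono) (use assms in auto)
  then show ?thesis using assms by (simp add: ln_div algebra_simps)
qed

lemma fixed_point_recursion_le:
  assumes X: "r = conv_pmf p (random_sum_pmf r q)" and \<rho>: "b < \<rho>" "\<rho> < 1" and c: "1 < c"
  shows "\<forall>\<^sub>F x in at_top. tail_pmf r x \<le> c / x + tail_pmf r (x / \<rho>)"
proof -
  have "max (1 / c) (b / \<rho>) < 1" using \<rho> c b by simp
  then obtain s where s: "max (1 / c) (b / \<rho>) < s" "s < 1" using dense by blast
  have "0 < 1 / c" using c by simp
  then have "0 < s" using s by (meson less_trans max_less_iff_conj)
  then have s0: "0 < s" "1 / s < c" "b < s * \<rho>" using s c \<rho> b by (auto simp: field_simps)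
  define e where "e = (c - 1 / s) / 3"
  have e: "0 < e" using s0 by (simp add: e_def)
  obtain C where C: "0 \<le> C" "\<And>K. 1 \<le> K \<Longrightarrow> truncated_mean p K \<le> C * (2 + ln K)"
    using truncated_mean_log_bound[OF tail_p] by blast
  define M where "M = C * (3 + \<bar>ln (s * \<rho>)\<bar>) / (1 - b)"
  have M: "0 \<le> M" using C b by (simp add: M_def)
  have "0 < s * e / (M + 1)" using s0 e M by simp
  then obtain x0 where x0: "1 \<le> x0"
    "\<And>x L r. x0 \<le> x \<Longrightarrow> 0 \<le> L \<Longrightarrow> partial_mean r (x / (s * \<rho>)) \<le> L * ln x \<Longrightarrow>
      tail_pmf (random_sum_pmf r q) x \<le> tail_pmf r (x / (s * \<rho>)) + L * (s * e / (M + 1)) / x"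
    using tail_step_le[OF s0(3)] by blast
  have pm: "partial_mean r (x / (s * \<rho>)) \<le> M * ln x" if "exp 1 \<le> x" for x
  proof -
    have "(1 :: real) \<le> exp 1" by simp
    then have x: "1 \<le> x" "1 \<le> ln x" using that by (simp_all add: ln_ge_iff del: one_le_exp_iff)
    have a: "0 < s * \<rho>" "s * \<rho> \<le> 1" using s0 s(2) \<rho> b by (auto intro!: mult_le_one)
    then have K: "1 \<le> x / (s * \<rho>)" using x by (simp add: field_simps)
    have "(1 - b) * partial_mean r (x / (s * \<rho>)) \<le> truncated_mean p (x / (s * \<rho>))"
      by (rule fixed_point_partial_mean_le[OF X]) (use K in linarith)
    also have "\<dots> \<le> C * (2 + ln (x / (s * \<rho>)))" by (rule C(2)[OF K])
    also have "\<dots> \<le> C * ((3 + \<bar>ln (s * \<rho>)\<bar>) * ln x)"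
      using x a by (intro mult_left_mono log_scaled_bound C(1)) auto
    finally show ?thesis using b by (simp add: M_def field_simps)
  qed
  have 1: "\<forall>\<^sub>F x in at_top. x * tail_pmf p (s * x) < 1 / s + e"
    by (rule order_tendstoD(2)[OF tendsto_scaled_tail[OF tail_p s0(1)]]) (use e in simp)
  have 2: "\<forall>\<^sub>F x in at_top. tail_pmf (random_sum_pmf r q) (s * x) \<le> tail_pmf r (x / \<rho>) + e / x"
    using eventually_ge_at_top[of "max x0 (exp 1) / s"] eventually_gt_at_top[of 0]
  proof eventually_elim
    case (elim x)
    then have "x0 \<le> s * x" "exp 1 \<le> s * x" using s0 by (auto simp: field_simps)
    from x0(2)[OF this(1) M pm[OF this(2)]]
    have "tail_pmf (random_sum_pmf r q) (s * x)
        \<le> tail_pmf r (x / \<rho>) + M * (s * e / (M + 1)) / (s * x)"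
      using s0 by simp
    also have "M * (s * e / (M + 1)) / (s * x) = e / x * (M / (M + 1))" using s0 by (simp add: mult_ac)
    also have "\<dots> \<le> e / x * 1" using M e elim by (intro mult_left_mono) auto
    finally show ?case by simp
  qed
  have "filterlim (\<lambda>x. (1 - s) * x) at_top at_top"
    by (rule filterlim_tendsto_pos_mult_at_top[OF tendsto_const _ filterlim_ident]) (use s in simp)
  then have "((\<lambda>x. x * tail_pmf p ((1 - s) * x) * tail_pmf (random_sum_pmf r q) ((1 - s) * x))
      \<longlongrightarrow> 1 / (1 - s) * 0) at_top"
    using s by (intro tendsto_mult tendsto_scaled_tail[OF tail_p]
        filterlim_compose[OF tail_pmf_tendsto_0]) auto
  then have 3: "\<forall>\<^sub>F x in at_top.
      x * tail_pmf p ((1 - s) * x) * tail_pmf (random_sum_pmf r q) ((1 - s) * x) < e"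
    using e by (intro order_tendstoD(2)) auto
  show ?thesis
    using 1 2 3 eventually_gt_at_top[of 0]
  proof eventually_elim
    case (elim x)
    have "tail_pmf r x \<le> tail_pmf p (s * x) + tail_pmf (random_sum_pmf r q) (s * x)
        + tail_pmf p ((1 - s) * x) * tail_pmf (random_sum_pmf r q) ((1 - s) * x)"
      by (subst (1) X) (rule tail_conv_pmf_le, simp add: algebra_simps)
    also have "tail_pmf p (s * x) \<le> (1 / s + e) / x" using elim by (simp add: field_simps)
    also have "tail_pmf (random_sum_pmf r q) (s * x) \<le> tail_pmf r (x / \<rho>) + e / x" by fact
    also have "tail_pmf p ((1 - s) * x) * tail_pmf (random_sum_pmf r q) ((1 - s) * x) \<le> e / x"
      using elim by (simp add: field_simps)
    finally have "tail_pmf r x \<le> (1 / s + e + e + e) / x + tail_pmf r (x / \<rho>)"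
      by (simp add: add_divide_distrib)
    also have "1 / s + e + e + e = c"
    proof -
      have "3 * e = c - 1 / s" by (simp add: e_def)
      then show ?thesis by linarith
    qed
    finally show ?case .
  qed
qed

lemma fixed_point_recursion_ge:
  assumes X: "r = conv_pmf p (random_sum_pmf r q)" and a: "0 < a" "a < 1"
  shows "\<forall>\<^sub>F x in at_top. a / x + a * tail_pmf r (x / (a * b)) \<le> tail_pmf r x"
proof -
  define \<eta> where "\<eta> = (1 - a) / 2"
  have \<eta>: "0 < \<eta>" "\<eta> < 1" "a \<le> (1 - \<eta>) * (1 - \<eta>)"
    using a zero_le_square[of "1 - a"] by (auto simp: \<eta>_def field_simps)
  obtain x0 where x0: "\<And>x r. x0 \<le> x \<Longrightarrow>
      (1 - \<eta>) * tail_pmf r (x / (a * b)) \<le> tail_pmf (random_sum_pmf r q) x"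
    using tail_step_ge[of "a * b" \<eta>] a b \<eta>(1) by auto
  show ?thesis
    using order_tendstoD(1)[OF tail_p a(2)] order_tendstoD(2)[OF tail_pmf_tendsto_0[of p] \<eta>(1)]
      eventually_ge_at_top[of x0] eventually_gt_at_top[of 0]
  proof eventually_elim
    case (elim x)
    let ?u = "tail_pmf p x" and ?v = "tail_pmf (random_sum_pmf r q) x"
    have "a * tail_pmf r (x / (a * b)) \<le> (1 - \<eta>) * (1 - \<eta>) * tail_pmf r (x / (a * b))"
      by (rule mult_right_mono) (use \<eta> in auto)
    also have "\<dots> \<le> (1 - \<eta>) * ?v"
      using x0[OF elim(3), of r] \<eta> by (simp add: mult.assoc mult_left_mono)
    also have "\<dots> \<le> (1 - ?u) * ?v" using elim by (intro mult_right_mono) auto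
    finally have "a * tail_pmf r (x / (a * b)) \<le> (1 - ?u) * ?v" .
    moreover have "a / x \<le> ?u" using elim by (simp add: field_simps)
    ultimately have "a / x + a * tail_pmf r (x / (a * b)) \<le> ?u + (1 - ?u) * ?v" by linarith
    also have "\<dots> \<le> tail_pmf r x"
      using tail_conv_pmf_ge[of p x "random_sum_pmf r q"] unfolding X[symmetric]
      by (simp add: algebra_simps)
    finally show ?case .
  qed
qed

lemma fixed_point_tail:
  assumes X: "r = conv_pmf p (random_sum_pmf r q)"
  shows "((\<lambda>x. x * tail_pmf r x) \<longlongrightarrow> 1 / (1 - b)) at_top"
proof (rule order_tendstoI)
  fix u assume u: "1 / (1 - b) < u"
  have u0: "0 < u" by (rule less_trans[OF _ u]) (use b in simp)
  have "b < 1 - 1 / u" using u u0 b by (simp add: field_simps)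
  then obtain \<rho> where \<rho>: "b < \<rho>" "\<rho> < 1 - 1 / u" using dense by blast
  then have \<rho>1: "\<rho> < 1" using u0 by (smt (verit) divide_pos_pos)
  have "1 < u * (1 - \<rho>)" using \<rho> u0 by (simp add: field_simps)
  then obtain c where c: "1 < c" "c < u * (1 - \<rho>)" using dense by blast
  obtain x0 where x0: "\<And>x. x0 \<le> x \<Longrightarrow> tail_pmf r x \<le> c / x + tail_pmf r (x / \<rho>)"
    using fixed_point_recursion_le[OF X \<rho>(1) \<rho>1 c(1)] unfolding eventually_at_top_linorder by blast
  show "\<forall>\<^sub>F x in at_top. x * tail_pmf r x < u"
    using eventually_ge_at_top[of "max 1 x0"]
  proof eventually_elim
    case (elim x)
    have "tail_pmf r x \<le> c / (1 - \<rho>) / x"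
      by (rule recursive_upper_bound[OF tail_pmf_tendsto_0, of "max 1 x0"])
        (use \<rho> \<rho>1 b c x0 elim in auto)
    then have "x * tail_pmf r x \<le> c / (1 - \<rho>)"
      using elim by (subst mult.commute) (rule pos_le_divide_eq[THEN iffD1], auto)
    also have "\<dots> < u" using c \<rho>1 by (simp add: field_simps)
    finally show ?case .
  qed
next
  fix l assume l: "l < 1 / (1 - b)"
  have "((\<lambda>a. a / (1 - a * (a * b))) \<longlongrightarrow> 1 / (1 - 1 * (1 * b))) (at_left 1)"
    by (intro tendsto_intros) (use b in auto)
  then have "\<forall>\<^sub>F a in at_left 1. l < a / (1 - a * (a * b))"
    using l by (intro order_tendstoD(1)) auto
  moreover have "\<forall>\<^sub>F a in at_left (1 :: real). a \<in> {0<..<1}"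
    by (rule eventually_at_left_real) simp
  ultimately have "\<forall>\<^sub>F a in at_left 1. l < a / (1 - a * (a * b)) \<and> a \<in> {0<..<1}"
    by (rule eventually_conj)
  then obtain a where a: "l < a / (1 - a * (a * b))" "0 < a" "a < 1"
    using eventually_happens[of _ "at_left (1 :: real)"] by (auto simp: trivial_limit_at_left_real)
  obtain x0 where x0: "\<And>x. x0 \<le> x \<Longrightarrow> a / x + a * tail_pmf r (x / (a * b)) \<le> tail_pmf r x"
    using fixed_point_recursion_ge[OF X a(2,3)] unfolding eventually_at_top_linorder by blast
  have ab: "0 < a * b" "a * b < 1" using a b mult_strict_mono[of a 1 b 1] by auto
  show "\<forall>\<^sub>F x in at_top. l < x * tail_pmf r x"
    using eventually_ge_at_top[of "max 1 x0"]
  proof eventually_elim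
    case (elim x)
    have "a / (1 - a * (a * b)) / x \<le> tail_pmf r x"
      by (rule recursive_lower_bound[of "tail_pmf r" "max 1 x0"]) (use ab a x0 elim in auto)
    then have "a / (1 - a * (a * b)) \<le> x * tail_pmf r x"
      using elim by (subst mult.commute) (rule pos_divide_le_eq[THEN iffD1], auto)
    with a(1) show ?case by linarith
  qed
qed

end

section \<open>Branching aggregates\<close>

definition aggregate_pmf :: "nat pmf \<Rightarrow> nat pmf \<Rightarrow> nat \<Rightarrow> nat pmf" where
  "aggregate_pmf p q n = ((\<lambda>r. random_sum_pmf r q) ^^ n) p"

lemma aggregate_pmf_0 [simp]: "aggregate_pmf p q 0 = p"
  and aggregate_pmf_Suc [simp]: "aggregate_pmf p q (Suc n) = random_sum_pmf (aggregate_pmf p q n) q"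
  by (simp_all add: aggregate_pmf_def)

text \<open>
  The recursion for \<open>d\<close> adds a generation at the root, \<open>aggregate_pmf\<close> adds one at the leaves.
\<close>

lemma random_sum_pmf_eq_aggregate_pmf:
  assumes "d 1 = q" and "\<And>n. 1 \<le> n \<Longrightarrow> d (n + 1) = random_sum_pmf q (d n)" and "1 \<le> n"
  shows "random_sum_pmf p (d n) = aggregate_pmf p q n"
  using \<open>1 \<le> n\<close>
proof (induction n arbitrary: p rule: dec_induct)
  case base
  then show ?case using assms(1) by (simp add: aggregate_pmf_def)
next
  case (step n)
  have "random_sum_pmf p (d (Suc n)) = random_sum_pmf (random_sum_pmf p q) (d n)"
    using assms(2)[OF step(1)] by (simp add: random_sum_pmf_assoc)
  then show ?case
    using funpow_swap1[of "\<lambda>r. random_sum_pmf r q" n p] by (simp add: step.IH aggregate_pmf_def)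
qed

lemma truncated_mean_random_sum_pmf_scaled:
  assumes "0 \<le> K" "0 < b" and b: "\<And>K. truncated_mean q K \<le> b"
  shows "truncated_mean (random_sum_pmf r q) K \<le> b * truncated_mean r (K / b)"
proof -
  have "b * min (real n) (K / b) = min (b * real n) K" for n
    using \<open>0 < b\<close> by (auto simp: min_def field_simps)
  then show ?thesis
    using truncated_mean_random_sum_pmf_le[OF assms(1) b, where p = r]
    unfolding integral_mult_right_zero[symmetric] by simp
qed

lemma summable_square_times_geometric:
  fixes \<rho> :: real
  assumes "0 < \<rho>" "\<rho> < 1"
  shows "summable (\<lambda>n. (real n)\<^sup>2 * \<rho> ^ n)"
proof -
  define r where "r = sqrt (sqrt \<rho>)"
  have r: "0 < r" "r < 1" using assms by (simp_all add: r_def)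
  have "(r\<^sup>2)\<^sup>2 = \<rho>" using assms by (simp add: r_def)
  then have r4: "r ^ 4 = \<rho>" by (simp flip: power_mult)
  have "(\<lambda>n. real n * r ^ n) \<longlonglongrightarrow> 0"
    using r powser_times_n_limit_0[of r] by simp
  then obtain C where C: "\<And>n. norm (real n * r ^ n) \<le> C"
    using BseqE[OF convergent_imp_Bseq[OF convergentI]] by metis
  show ?thesis
  proof (rule summable_comparison_test)
    show "summable (\<lambda>n. C\<^sup>2 * (r\<^sup>2) ^ n)"
      using r by (intro summable_mult summable_geometric) (simp add: abs_square_less_1)
    have "(real n)\<^sup>2 * \<rho> ^ n \<le> C\<^sup>2 * (r\<^sup>2) ^ n" for n
    proof -
      have "\<rho> ^ n = (r ^ n)\<^sup>2 * (r\<^sup>2) ^ n"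
        by (simp add: r4[symmetric] power_mult[symmetric] power_add[symmetric])
      then have "(real n)\<^sup>2 * \<rho> ^ n = (real n * r ^ n)\<^sup>2 * (r\<^sup>2) ^ n"
        by (simp only: power_mult_distrib mult.assoc)
      also have "\<dots> \<le> C\<^sup>2 * (r\<^sup>2) ^ n"
        using C[of n] r by (intro mult_right_mono power_mono) simp_all
      finally show ?thesis .
    qed
    then show "\<exists>N. \<forall>n\<ge>N. norm ((real n)\<^sup>2 * \<rho> ^ n) \<le> C\<^sup>2 * (r\<^sup>2) ^ n"
      using assms by auto
  qed
qed

context branching_tail
begin

lemma truncated_mean_aggregate_pmf_le:
  assumes "0 \<le> K"
  shows "truncated_mean (aggregate_pmf p q n) K \<le> b ^ n * truncated_mean p (K / b ^ n)"
  using assms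
proof (induction n arbitrary: K)
  case (Suc n)
  have "truncated_mean (aggregate_pmf p q (Suc n)) K \<le> b * truncated_mean (aggregate_pmf p q n) (K / b)"
    using truncated_mean_random_sum_pmf_scaled[OF Suc.prems b(1) truncated_mean_q_le] by simp
  also have "\<dots> \<le> b * (b ^ n * truncated_mean p (K / b / b ^ n))"
    using Suc.prems b by (intro mult_left_mono Suc.IH) auto
  finally show ?case by simp
qed simp

lemma partial_mean_aggregate_pmf_le:
  assumes \<rho>: "0 < \<rho>" "\<rho> < 1"
  obtains M where "0 \<le> M" "\<And>n x. exp 1 \<le> x \<Longrightarrow>
    partial_mean (aggregate_pmf p q n) (x / \<rho>) \<le> M * (real n + 1) * b ^ n * ln x"
proof -
  obtain C where C: "0 \<le> C" "\<And>K. 1 \<le> K \<Longrightarrow> truncated_mean p K \<le> C * (2 + ln K)"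
    using truncated_mean_log_bound[OF tail_p] by blast
  define M where "M = C * (3 + \<bar>ln \<rho>\<bar> + \<bar>ln b\<bar>)"
  have "partial_mean (aggregate_pmf p q n) (x / \<rho>) \<le> M * (real n + 1) * b ^ n * ln x"
    if x: "exp 1 \<le> x" for n x
  proof -
    have "(1 :: real) \<le> exp 1" by simp
    then have x: "1 \<le> x" "1 \<le> ln x" using x by (simp_all add: ln_ge_iff del: one_le_exp_iff)
    have a: "0 < \<rho> * b ^ n" "\<rho> * b ^ n \<le> 1" using \<rho> b by (auto intro!: mult_le_one power_le_one)
    then have K: "1 \<le> x / \<rho> / b ^ n" using x by (simp add: field_simps)
    have "\<bar>ln (\<rho> * b ^ n)\<bar> \<le> \<bar>ln \<rho>\<bar> + real n * \<bar>ln b\<bar>"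
      using \<rho> b abs_triangle_ineq[of "ln \<rho>" "real n * ln b"]
      by (simp add: ln_mult ln_realpow abs_mult)
    also have "3 + \<dots> \<le> (real n + 1) * (3 + \<bar>ln \<rho>\<bar> + \<bar>ln b\<bar>)" by (simp add: algebra_simps)
    finally have log: "3 + \<bar>ln (\<rho> * b ^ n)\<bar> \<le> (real n + 1) * (3 + \<bar>ln \<rho>\<bar> + \<bar>ln b\<bar>)" by simp
    have "partial_mean (aggregate_pmf p q n) (x / \<rho>) \<le> truncated_mean (aggregate_pmf p q n) (x / \<rho>)"
      using x \<rho> by (intro partial_mean_le_truncated_mean) auto
    also have "\<dots> \<le> b ^ n * truncated_mean p (x / \<rho> / b ^ n)"
      using x \<rho> by (intro truncated_mean_aggregate_pmf_le) auto
    also have "\<dots> \<le> b ^ n * (C * (2 + ln (x / \<rho> / b ^ n)))"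
      using b by (intro mult_left_mono C(2) K) auto
    also have "\<dots> = b ^ n * (C * (2 + ln (x / (\<rho> * b ^ n))))" by simp
    also have "\<dots> \<le> b ^ n * (C * ((3 + \<bar>ln (\<rho> * b ^ n)\<bar>) * ln x))"
      using x a b by (intro mult_left_mono log_scaled_bound C(1)) auto
    also have "\<dots> \<le> b ^ n * (C * (((real n + 1) * (3 + \<bar>ln \<rho>\<bar> + \<bar>ln b\<bar>)) * ln x))"
      using x b by (intro mult_left_mono mult_right_mono log C(1)) auto
    also have "\<dots> = M * (real n + 1) * b ^ n * ln x" by (simp add: M_def)
    finally show ?thesis .
  qed
  moreover have "0 \<le> M" using C by (simp add: M_def)
  ultimately show thesis using that by blast
qed

lemma aggregate_pmf_tail:
  "((\<lambda>x. x * tail_pmf (aggregate_pmf p q n) x) \<longlongrightarrow> b ^ n) at_top"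
proof (induction n)
  case 0
  then show ?case using tail_p by simp
next
  case (Suc n)
  let ?s = "aggregate_pmf p q n"
  show ?case
  proof (rule order_tendstoI)
    fix u assume u: "b ^ Suc n < u"
    have "b < min 1 (u / b ^ n)" using u b by (simp add: field_simps)
    then obtain \<rho> where "b < \<rho>" "\<rho> < min 1 (u / b ^ n)" using dense by blast
    then have \<rho>: "b < \<rho>" "0 < \<rho>" "\<rho> < 1" "\<rho> * b ^ n < u" using b by (auto simp: field_simps)
    obtain M where M: "0 \<le> M" "\<And>n x. exp 1 \<le> x \<Longrightarrow>
        partial_mean (aggregate_pmf p q n) (x / \<rho>) \<le> M * (real n + 1) * b ^ n * ln x"
      using partial_mean_aggregate_pmf_le[OF \<rho>(2,3)] by blast
    define M' where "M' = M * (real n + 1) * b ^ n"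
    have M': "0 \<le> M'" using M b by (simp add: M'_def)
    define \<eta> where "\<eta> = (u - \<rho> * b ^ n) / (2 * (M' + 1))"
    have \<eta>: "0 < \<eta>" using \<rho> M' by (simp add: \<eta>_def)
    obtain x0 where x0: "1 \<le> x0"
      "\<And>x M r. x0 \<le> x \<Longrightarrow> 0 \<le> M \<Longrightarrow> partial_mean r (x / \<rho>) \<le> M * ln x \<Longrightarrow>
        tail_pmf (random_sum_pmf r q) x \<le> tail_pmf r (x / \<rho>) + M * \<eta> / x"
      using tail_step_le[OF \<rho>(1) \<eta>] by blast
    have "((\<lambda>x. x * tail_pmf ?s (inverse \<rho> * x)) \<longlongrightarrow> b ^ n / inverse \<rho>) at_top"
      by (rule tendsto_scaled_tail[OF Suc]) (use \<rho> in simp)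
    moreover have "b ^ n / inverse \<rho> < \<rho> * b ^ n + (u - \<rho> * b ^ n) / 2" using \<rho> by (simp add: field_simps)
    ultimately have "\<forall>\<^sub>F x in at_top. x * tail_pmf ?s (inverse \<rho> * x)
        < \<rho> * b ^ n + (u - \<rho> * b ^ n) / 2"
      by (rule order_tendstoD(2))
    then show "\<forall>\<^sub>F x in at_top. x * tail_pmf (aggregate_pmf p q (Suc n)) x < u"
      using eventually_ge_at_top[of "max x0 (exp 1)"]
    proof eventually_elim
      case (elim x)
      then have x: "x0 \<le> x" "exp 1 \<le> x" "0 < x" using x0(1) by auto
      have "tail_pmf (random_sum_pmf ?s q) x \<le> tail_pmf ?s (x / \<rho>) + M' * \<eta> / x"
        using M(2)[OF x(2), of n] by (intro x0(2) x M') (simp add: M'_def)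
      then have "x * tail_pmf (random_sum_pmf ?s q) x \<le> x * (tail_pmf ?s (x / \<rho>) + M' * \<eta> / x)"
        using x by (intro mult_left_mono) auto
      also have "\<dots> = x * tail_pmf ?s (inverse \<rho> * x) + M' * \<eta>"
        using x by (simp add: field_simps)
      also have "M' * \<eta> \<le> (u - \<rho> * b ^ n) / 2 * 1"
      proof -
        have "M' * \<eta> = (u - \<rho> * b ^ n) / 2 * (M' / (M' + 1))" by (simp add: \<eta>_def)
        also have "\<dots> \<le> (u - \<rho> * b ^ n) / 2 * 1" using M' \<rho> by (intro mult_left_mono) auto
        finally show ?thesis .
      qed
      finally have "x * tail_pmf (random_sum_pmf ?s q) x
          \<le> x * tail_pmf ?s (inverse \<rho> * x) + (u - \<rho> * b ^ n) / 2" by simp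
      then show ?case using elim(1) unfolding aggregate_pmf_Suc by argo
    qed
  next
    fix l assume l: "l < b ^ Suc n"
    have "((\<lambda>a. (1 - (1 - a)) * (a * b * b ^ n)) \<longlongrightarrow> (1 - (1 - 1)) * (1 * b * b ^ n)) (at_left 1)"
      by (intro tendsto_intros)
    then have "\<forall>\<^sub>F a in at_left 1. l < (1 - (1 - a)) * (a * b * b ^ n)"
      using l by (intro order_tendstoD(1)) auto
    moreover have "\<forall>\<^sub>F a in at_left (1 :: real). a \<in> {0<..<1}"
      by (rule eventually_at_left_real) simp
    ultimately have "\<forall>\<^sub>F a in at_left 1. l < (1 - (1 - a)) * (a * b * b ^ n) \<and> a \<in> {0<..<1}"
      by (rule eventually_conj)
    then obtain a where a: "l < a * (a * b * b ^ n)" "0 < a" "a < 1"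
      using eventually_happens[of _ "at_left (1 :: real)"] by (auto simp: trivial_limit_at_left_real)
    obtain x0 where x0: "\<And>x r. x0 \<le> x \<Longrightarrow>
        a * tail_pmf r (x / (a * b)) \<le> tail_pmf (random_sum_pmf r q) x"
      using tail_step_ge[of "a * b" "1 - a"] a b by auto
    have "((\<lambda>x. a * (x * tail_pmf ?s (inverse (a * b) * x))) \<longlongrightarrow> a * (b ^ n / inverse (a * b))) at_top"
      by (intro tendsto_mult tendsto_const tendsto_scaled_tail[OF Suc]) (use a b in simp)
    moreover have "l < a * (b ^ n / inverse (a * b))" using a b by (simp add: field_simps)
    ultimately have "\<forall>\<^sub>F x in at_top. l < a * (x * tail_pmf ?s (inverse (a * b) * x))"
      by (rule order_tendstoD(1))
    then show "\<forall>\<^sub>F x in at_top. l < x * tail_pmf (aggregate_pmf p q (Suc n)) x"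
      using eventually_ge_at_top[of x0] eventually_gt_at_top[of 0]
    proof eventually_elim
      case (elim x)
      have "a * (x * tail_pmf ?s (inverse (a * b) * x)) = x * (a * tail_pmf ?s (x / (a * b)))"
        by (simp add: field_simps)
      also have "\<dots> \<le> x * tail_pmf (random_sum_pmf ?s q) x"
        using x0[OF elim(2)] elim(3) by (intro mult_left_mono) auto
      finally show ?case using elim(1) by simp
    qed
  qed
qed

lemma aggregate_pmf_tail_dominated:
  obtains c x0 where "summable c"
    "\<And>n x. x0 \<le> x \<Longrightarrow> x * tail_pmf (aggregate_pmf p q n) x \<le> c n"
proof -
  define \<rho> where "\<rho> = (1 + b) / 2"
  have \<rho>: "b < \<rho>" "0 < \<rho>" "\<rho> < 1" using b by (auto simp: \<rho>_def)
  obtain M where M: "0 \<le> M" "\<And>n x. exp 1 \<le> x \<Longrightarrow>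
      partial_mean (aggregate_pmf p q n) (x / \<rho>) \<le> M * (real n + 1) * b ^ n * ln x"
    using partial_mean_aggregate_pmf_le[OF \<rho>(2,3)] by blast
  obtain x1 where x1: "1 \<le> x1"
    "\<And>x M r. x1 \<le> x \<Longrightarrow> 0 \<le> M \<Longrightarrow> partial_mean r (x / \<rho>) \<le> M * ln x \<Longrightarrow>
      tail_pmf (random_sum_pmf r q) x \<le> tail_pmf r (x / \<rho>) + M * 1 / x"
    using tail_step_le[OF \<rho>(1) zero_less_one] by blast
  obtain x2 where x2: "\<And>x. x2 \<le> x \<Longrightarrow> x * tail_pmf p x < 2"
    using order_tendstoD(2)[OF tail_p, of 2] unfolding eventually_at_top_linorder by auto
  define c where "c = (\<lambda>n. (2 + M / \<rho> * (real n)\<^sup>2) * \<rho> ^ n)"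
  have "summable (\<lambda>n. 2 * \<rho> ^ n + M / \<rho> * ((real n)\<^sup>2 * \<rho> ^ n))"
    using \<rho> by (intro summable_add summable_mult summable_square_times_geometric summable_geometric) auto
  then have "summable c" by (simp add: c_def algebra_simps)
  moreover have "x * tail_pmf (aggregate_pmf p q n) x \<le> c n"
    if "max (max x1 x2) (exp 1) \<le> x" for n x
    using that
  proof (induction n arbitrary: x)
    case 0
    then show ?case using x2[of x] by (simp add: c_def)
  next
    case (Suc n)
    let ?s = "aggregate_pmf p q n"
    have x: "x1 \<le> x" "exp 1 \<le> x" "0 < x" using Suc.prems x1(1) by auto
    have "x \<le> x / \<rho>" using x \<rho> by (simp add: field_simps)
    then have IH: "x / \<rho> * tail_pmf ?s (x / \<rho>) \<le> c n" using Suc.prems by (intro Suc.IH) linarith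
    have "tail_pmf (random_sum_pmf ?s q) x \<le> tail_pmf ?s (x / \<rho>) + M * (real n + 1) * b ^ n * 1 / x"
      using M b by (intro x1(2) x M(2)) auto
    then have "x * tail_pmf (random_sum_pmf ?s q) x
        \<le> x * (tail_pmf ?s (x / \<rho>) + M * (real n + 1) * b ^ n * 1 / x)"
      using x by (intro mult_left_mono) auto
    also have "\<dots> = \<rho> * (x / \<rho> * tail_pmf ?s (x / \<rho>)) + M * (real n + 1) * b ^ n"
      using x \<rho> by (simp add: field_simps)
    also have "\<dots> \<le> \<rho> * c n + M * (real n + 1) * \<rho> ^ n"
      using IH \<rho> b M by (intro add_mono mult_left_mono power_mono) auto
    also have "\<dots> \<le> \<rho> * c n + M * (2 * real n + 1) * \<rho> ^ n"
      using \<rho> M by (intro add_left_mono mult_right_mono mult_left_mono) auto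
    also have "\<dots> = c (Suc n)"
      using \<rho> by (simp add: c_def field_simps power2_eq_square)
    finally show ?case by simp
  qed
  ultimately show thesis using that by blast
qed

lemma aggregate_pmf_tail_sum:
  shows "\<forall>\<^sub>F x in at_top. summable (\<lambda>n. tail_pmf (aggregate_pmf p q (Suc n)) x)"
    and "((\<lambda>x. x * (\<Sum>n. tail_pmf (aggregate_pmf p q (Suc n)) x)) \<longlongrightarrow> b / (1 - b)) at_top"
proof -
  let ?a = "\<lambda>n x. x * tail_pmf (aggregate_pmf p q (Suc n)) x"
  obtain c x0 where c: "summable c"
      "\<And>n x. x0 \<le> x \<Longrightarrow> x * tail_pmf (aggregate_pmf p q n) x \<le> c n"
    using aggregate_pmf_tail_dominated by blast
  have bound: "\<forall>\<^sub>F x in at_top. \<forall>n. norm (?a n x) \<le> c (Suc n)"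
    using eventually_ge_at_top[of "max 0 x0"]
    by eventually_elim (use c(2) in \<open>auto simp del: aggregate_pmf_Suc\<close>)
  have prod: "\<forall>\<^sub>F (n, x) in sequentially \<times>\<^sub>F at_top. norm (?a n x) \<le> c (Suc n)"
    unfolding eventually_prod_filter using bound
    by (intro exI[of _ "\<lambda>_. True"] exI[of _ "\<lambda>x. \<forall>n. norm (?a n x) \<le> c (Suc n)"]) auto
  have "summable (\<lambda>n. c (Suc n))" using c(1) by (simp add: summable_Suc_iff)
  note T = tannerys_theorem[OF aggregate_pmf_tail prod this trivial_limit_at_top_linorder]
  from T have *: "\<forall>\<^sub>F x in at_top. summable (\<lambda>n. norm (?a n x))"
      "((\<lambda>x. \<Sum>n. ?a n x) \<longlongrightarrow> (\<Sum>n. b ^ Suc n)) at_top"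
    by (blast dest: conjunct1, blast dest: conjunct2)
  have ev: "\<forall>\<^sub>F x in at_top. summable (\<lambda>n. tail_pmf (aggregate_pmf p q (Suc n)) x) \<and>
      (\<Sum>n. ?a n x) = x * (\<Sum>n. tail_pmf (aggregate_pmf p q (Suc n)) x)"
    using *(1) eventually_gt_at_top[of 0]
  proof eventually_elim
    case (elim x)
    then have "summable (\<lambda>n. inverse x * ?a n x)"
      by (intro summable_mult) (simp add: abs_mult)
    then have s: "summable (\<lambda>n. tail_pmf (aggregate_pmf p q (Suc n)) x)" using elim(2) by simp
    from suminf_mult[OF s, of x] s show ?case by simp
  qed
  then show "\<forall>\<^sub>F x in at_top. summable (\<lambda>n. tail_pmf (aggregate_pmf p q (Suc n)) x)"
    by eventually_elim simp
  have "(\<Sum>n. b ^ Suc n) = b / (1 - b)"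
    using suminf_mult[OF summable_geometric[of b], of b] suminf_geometric[of b] b by simp
  with *(2) have "((\<lambda>x. \<Sum>n. ?a n x) \<longlongrightarrow> b / (1 - b)) at_top" by simp
  then show "((\<lambda>x. x * (\<Sum>n. tail_pmf (aggregate_pmf p q (Suc n)) x)) \<longlongrightarrow> b / (1 - b)) at_top"
    by (rule Lim_transform_eventually) (use ev in \<open>auto elim: eventually_mono\<close>)
qed

end

section \<open>Transfer to random variables\<close>

definition law :: "'a measure \<Rightarrow> ('a \<Rightarrow> 'b :: countable) \<Rightarrow> 'b pmf" where
  "law M Y = Abs_pmf (distr M (count_space UNIV) Y)"

lemma law_cong: "eq_law M Y Z \<Longrightarrow> law M Y = law M Z"
  by (simp add: eq_law_def law_def)

lemma measurable_add_count_space: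
  fixes f g :: "'a \<Rightarrow> nat"
  assumes "f \<in> measurable N (count_space UNIV)" "g \<in> measurable N (count_space UNIV)"
  shows "(\<lambda>\<omega>. f \<omega> + g \<omega>) \<in> measurable N (count_space UNIV)"
  by (rule measurable_compose_countable[where f = "\<lambda>i \<omega>. i + g \<omega>", OF _ assms(1)])
     (rule measurable_compose[OF assms(2)], simp)

lemma measurable_sum_count_space:
  fixes f :: "'i \<Rightarrow> 'a \<Rightarrow> nat"
  assumes "finite S" "\<And>i. i \<in> S \<Longrightarrow> f i \<in> measurable N (count_space UNIV)"
  shows "(\<lambda>\<omega>. \<Sum>i\<in>S. f i \<omega>) \<in> measurable N (count_space UNIV)"
  using assms by (induction S rule: finite_induct) (auto intro: measurable_add_count_space)

lemma measurable_random_sum: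
  assumes "N \<in> measurable S (count_space UNIV)"
    and "\<And>i. 1 \<le> i \<Longrightarrow> Y i \<in> measurable S (count_space UNIV)"
  shows "random_sum N Y \<in> measurable S (count_space UNIV)"
  unfolding random_sum_def
  by (rule measurable_compose_countable[where f = "\<lambda>n \<omega>. \<Sum>i=1..n. Y i \<omega>", OF _ assms(1)])
     (rule measurable_sum_count_space, auto intro: assms(2))

context prob_space
begin

lemma measure_pmf_law:
  fixes Y :: "'a \<Rightarrow> 'b :: countable"
  assumes Y: "Y \<in> measurable M (count_space UNIV)"
  shows "measure_pmf (law M Y) = distr M (count_space UNIV) Y"
  unfolding law_def
proof (rule Abs_pmf_inverse, safe)
  let ?D = "distr M (count_space UNIV) Y"
  show D: "prob_space ?D" by (rule prob_space_distr[OF Y])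
  interpret D: prob_space ?D by fact
  have "AE x in ?D. \<forall>n. measure ?D {n} = 0 \<longrightarrow> x \<noteq> n"
    unfolding AE_all_countable
  proof
    fix n
    show "AE x in ?D. measure ?D {n} = 0 \<longrightarrow> x \<noteq> n"
    proof (cases "measure ?D {n} = 0")
      case True
      then have "{n} \<in> null_sets ?D" by (intro null_setsI) (simp_all add: D.emeasure_eq_measure)
      from AE_not_in[OF this] show ?thesis by auto
    qed simp
  qed
  then show "AE x in ?D. measure ?D {x} \<noteq> 0" by eventually_elim auto
qed simp_all

lemma prob_law:
  fixes Y :: "'a \<Rightarrow> 'b :: countable"
  assumes "Y \<in> measurable M (count_space UNIV)"
  shows "measure_pmf.prob (law M Y) S = prob (Y -` S \<inter> space M)"
  using assms by (simp add: measure_pmf_law measure_distr)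

lemma pmf_law:
  fixes Y :: "'a \<Rightarrow> 'b :: countable"
  assumes "Y \<in> measurable M (count_space UNIV)"
  shows "pmf (law M Y) y = prob (Y -` {y} \<inter> space M)"
  using prob_law[OF assms, of "{y}"] by (simp add: measure_pmf_single)

lemma tail_eq_tail_pmf:
  assumes "Y \<in> measurable M (count_space UNIV)"
  shows "tail M Y x = tail_pmf (law M Y) x"
  unfolding prob_law[OF assms] by (rule arg_cong[where f = prob]) auto

lemma law_map:
  fixes Y :: "'a \<Rightarrow> 'b :: countable" and f :: "'b \<Rightarrow> 'c :: countable"
  assumes "Y \<in> measurable M (count_space UNIV)"
  shows "law M (\<lambda>\<omega>. f (Y \<omega>)) = map_pmf f (law M Y)"
proof (rule pmf_eqI)
  fix c
  have m: "(\<lambda>\<omega>. f (Y \<omega>)) \<in> measurable M (count_space UNIV)"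
    by (rule measurable_compose[OF assms]) simp
  show "pmf (law M (\<lambda>\<omega>. f (Y \<omega>))) c = pmf (map_pmf f (law M Y)) c"
    by (simp add: pmf_law[OF m] pmf_map prob_law[OF assms] vimage_def)
qed

lemma law_pair:
  fixes Y Z :: "'a \<Rightarrow> nat"
  assumes ind: "indep_var (count_space UNIV) Y (count_space UNIV) Z"
  shows "law M (\<lambda>\<omega>. (Y \<omega>, Z \<omega>)) = pair_pmf (law M Y) (law M Z)"
proof (rule pmf_eqI)
  fix yz :: "nat \<times> nat"
  obtain y z where [simp]: "yz = (y, z)" by (cases yz)
  have Y: "Y \<in> measurable M (count_space UNIV)" and Z: "Z \<in> measurable M (count_space UNIV)"
    using indep_var_rv1[OF ind] indep_var_rv2[OF ind] by auto
  have YZ: "(\<lambda>\<omega>. (Y \<omega>, Z \<omega>)) \<in> measurable M (count_space UNIV)"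
    by (rule measurable_compose_countable[where f = "\<lambda>i \<omega>. (i, Z \<omega>)", OF _ Y])
       (rule measurable_compose[OF Z], simp)
  have "{(y, z)} = {y} \<times> {z}" by simp
  then show "pmf (law M (\<lambda>\<omega>. (Y \<omega>, Z \<omega>))) yz = pmf (pair_pmf (law M Y) (law M Z)) yz"
    using indep_varD[OF ind, of "{y}" "{z}"]
    by (simp add: pmf_law Y Z YZ pmf_pair)
qed

lemma law_add:
  fixes Y Z :: "'a \<Rightarrow> nat"
  assumes ind: "indep_var (count_space UNIV) Y (count_space UNIV) Z"
  shows "law M (\<lambda>\<omega>. Y \<omega> + Z \<omega>) = conv_pmf (law M Y) (law M Z)"
proof -
  have Y: "Y \<in> measurable M (count_space UNIV)" and Z: "Z \<in> measurable M (count_space UNIV)"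
    using indep_var_rv1[OF ind] indep_var_rv2[OF ind] by auto
  have YZ: "(\<lambda>\<omega>. (Y \<omega>, Z \<omega>)) \<in> measurable M (count_space UNIV)"
    by (rule measurable_compose_countable[where f = "\<lambda>i \<omega>. (i, Z \<omega>)", OF _ Y])
       (rule measurable_compose[OF Z], simp)
  show ?thesis
    using law_map[OF YZ, of "\<lambda>(x, y). x + y"] by (simp add: law_pair[OF ind] conv_pmf_def)
qed

lemma indep_var_of_disjoint:
  fixes W :: "'i \<Rightarrow> 'a \<Rightarrow> nat"
  assumes ind: "indep_nat_vars M W I" and JK: "J \<inter> K = {}" "J \<subseteq> I" "K \<subseteq> I"
    and F: "F \<in> measurable (PiM J (\<lambda>_. count_space UNIV)) (count_space UNIV)"
    and G: "G \<in> measurable (PiM K (\<lambda>_. count_space UNIV)) (count_space UNIV)"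
  shows "indep_var (count_space UNIV) (\<lambda>\<omega>. F (restrict (\<lambda>i. W i \<omega>) J))
    (count_space UNIV) (\<lambda>\<omega>. G (restrict (\<lambda>i. W i \<omega>) K))"
  using indep_var_compose[OF indep_var_restrict[OF ind JK] F G] by (simp add: comp_def)

lemma indep_nat_vars_measurable:
  "indep_nat_vars M W I \<Longrightarrow> i \<in> I \<Longrightarrow> W i \<in> measurable M (count_space UNIV)"
  by (simp add: indep_vars_def2)

lemma indep_var_sum:
  fixes W :: "'i \<Rightarrow> 'a \<Rightarrow> nat"
  assumes ind: "indep_nat_vars M W I" and h: "h \<in> I" and S: "finite S" "S \<subseteq> I" "h \<notin> S"
  shows "indep_var (count_space UNIV) (W h) (count_space UNIV) (\<lambda>\<omega>. \<Sum>i\<in>S. W i \<omega>)"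
proof -
  have "indep_var (count_space UNIV) (\<lambda>\<omega>. (\<lambda>f. f h) (restrict (\<lambda>i. W i \<omega>) {h}))
      (count_space UNIV) (\<lambda>\<omega>. (\<lambda>f. \<Sum>i\<in>S. f i) (restrict (\<lambda>i. W i \<omega>) S))"
    by (rule indep_var_of_disjoint[OF ind])
       (use assms in \<open>auto intro!: measurable_sum_count_space measurable_component_singleton\<close>)
  then show ?thesis by simp
qed

lemma law_sum_iid:
  fixes W :: "'i \<Rightarrow> 'a \<Rightarrow> nat"
  assumes ind: "indep_nat_vars M W I" and g: "inj_on g {1..}" "\<And>i. 1 \<le> i \<Longrightarrow> g i \<in> I"
    and q: "\<And>i. 1 \<le> i \<Longrightarrow> law M (W (g i)) = q"
  shows "law M (\<lambda>\<omega>. \<Sum>i=1..n. W (g i) \<omega>) = iid_sum_pmf q n"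
proof (induction n)
  case 0
  have "law M (\<lambda>\<omega>. 0 :: nat) = map_pmf (\<lambda>_. 0) (law M (\<lambda>_. 0 :: nat))"
    using law_map[of "\<lambda>_. 0 :: nat" "\<lambda>_. 0 :: nat"] by simp
  then show ?case by (simp add: map_pmf_const)
next
  case (Suc n)
  have eq: "(\<lambda>\<omega>. \<Sum>i\<in>g ` {1..n}. W i \<omega>) = (\<lambda>\<omega>. \<Sum>i=1..n. W (g i) \<omega>)"
    by (subst sum.reindex) (auto intro: inj_on_subset[OF g(1)])
  have "g (Suc n) \<notin> g ` {1..n}"
  proof
    assume "g (Suc n) \<in> g ` {1..n}"
    then obtain i where "i \<in> {1..n}" "g (Suc n) = g i" by blast
    then show False using inj_onD[OF g(1), of "Suc n" i] by simp
  qed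
  then have "indep_var (count_space UNIV) (W (g (Suc n)))
      (count_space UNIV) (\<lambda>\<omega>. \<Sum>i\<in>g ` {1..n}. W i \<omega>)"
    by (intro indep_var_sum[OF ind]) (auto intro: g(2))
  from law_add[OF this[unfolded eq], unfolded Suc.IH] show ?case
    by (simp add: q add.commute)
qed

lemma law_random_sum:
  fixes W :: "'i \<Rightarrow> 'a \<Rightarrow> nat"
  assumes ind: "indep_nat_vars M W I" and h: "h \<in> I"
    and g: "inj_on g {1..}" "\<And>i. 1 \<le> i \<Longrightarrow> g i \<in> I" "\<And>i. 1 \<le> i \<Longrightarrow> g i \<noteq> h"
    and q: "\<And>i. 1 \<le> i \<Longrightarrow> law M (W (g i)) = q"
  shows "law M (random_sum (W h) (\<lambda>i. W (g i))) = random_sum_pmf (law M (W h)) q"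
proof (rule pmf_eqI)
  fix k
  let ?R = "random_sum (W h) (\<lambda>i. W (g i))"
  let ?S = "\<lambda>n \<omega>. \<Sum>i=1..n. W (g i) \<omega>"
  let ?E = "\<lambda>n. W h -` {n} \<inter> space M \<inter> (?S n -` {k} \<inter> space M)"
  have mh: "W h \<in> measurable M (count_space UNIV)" by (rule indep_nat_vars_measurable[OF ind h])
  have mg: "W (g i) \<in> measurable M (count_space UNIV)" if "1 \<le> i" for i
    by (rule indep_nat_vars_measurable[OF ind g(2)[OF that]])
  have mR: "?R \<in> measurable M (count_space UNIV)" by (rule measurable_random_sum[OF mh mg])
  have mS: "?S n \<in> measurable M (count_space UNIV)" for n
    by (rule measurable_sum_count_space) (auto intro: mg)
  have E: "?E n \<in> sets M" for n
    using measurable_sets[OF mh, of "{n}"] measurable_sets[OF mS, of "{k}" n] by auto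
  have prod: "prob (?E n) = pmf (law M (W h)) n * pmf (iid_sum_pmf q n) k" for n
  proof -
    have eq: "(\<lambda>\<omega>. \<Sum>i\<in>g ` {1..n}. W i \<omega>) = ?S n"
      by (subst sum.reindex) (auto intro: inj_on_subset[OF g(1)])
    have "indep_var (count_space UNIV) (W h) (count_space UNIV) (\<lambda>\<omega>. \<Sum>i\<in>g ` {1..n}. W i \<omega>)"
      by (rule indep_var_sum[OF ind h]) (use g(2,3) in \<open>auto simp: eq_commute[of h]\<close>)
    then have "indep_var (count_space UNIV) (W h) (count_space UNIV) (?S n)" by (simp only: eq)
    from indep_varD[OF this, of "{n}" "{k}"]
    have "prob ((\<lambda>\<omega>. (W h \<omega>, ?S n \<omega>)) -` ({n} \<times> {k}) \<inter> space M)
        = prob (W h -` {n} \<inter> space M) * prob (?S n -` {k} \<inter> space M)"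
      by simp
    also have "(\<lambda>\<omega>. (W h \<omega>, ?S n \<omega>)) -` ({n} \<times> {k}) \<inter> space M = ?E n" by auto
    finally have "prob (?E n) = prob (W h -` {n} \<inter> space M) * prob (?S n -` {k} \<inter> space M)" .
    also have "prob (?S n -` {k} \<inter> space M) = pmf (iid_sum_pmf q n) k"
      using law_sum_iid[OF ind g(1,2) q, of n] by (metis pmf_law[OF mS])
    finally show ?thesis by (simp only: pmf_law[OF mh])
  qed
  have "ennreal (pmf (law M ?R) k) = emeasure M (?R -` {k} \<inter> space M)"
    by (simp add: pmf_law[OF mR] emeasure_eq_measure)
  also have "?R -` {k} \<inter> space M = (\<Union>n. ?E n)" by (auto simp: random_sum_def)
  also have "emeasure M \<dots> = (\<Sum>n. emeasure M (?E n))"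
    by (rule suminf_emeasure[symmetric], use E in blast) (auto simp: disjoint_family_on_def)
  also have "\<dots> = (\<Sum>n. ennreal (pmf (law M (W h)) n) * ennreal (pmf (iid_sum_pmf q n) k))"
    by (simp only: emeasure_eq_measure prod ennreal_mult' pmf_nonneg)
  also have "\<dots> = (\<integral>\<^sup>+n. pmf (iid_sum_pmf q n) k \<partial>law M (W h))"
    by (simp add: nn_integral_measure_pmf nn_integral_count_space_nat)
  also have "\<dots> = ennreal (pmf (random_sum_pmf (law M (W h)) q) k)"
    by (simp add: random_sum_pmf_def ennreal_pmf_bind)
  finally show "pmf (law M ?R) k = pmf (random_sum_pmf (law M (W h)) q) k"
    by (simp add: ennreal_inj)
qed

lemma law_fixed_point:
  assumes fp: "fixed_point M X A Bs" and q: "\<And>i. 1 \<le> i \<Longrightarrow> law M (Bs i) = q"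
  shows "law M X = conv_pmf (law M A) (random_sum_pmf (law M X) q)"
proof -
  obtain X' where X': "eq_law M X' X"
    and ind: "indep_nat_vars M (case_option X' (with_head A Bs)) UNIV"
    and eq: "eq_law M X (\<lambda>\<omega>. A \<omega> + random_sum X' Bs \<omega>)"
    using fp by (auto simp: fixed_point_def)
  let ?W = "case_option X' (with_head A Bs)"
  have "law M (random_sum (?W None) (\<lambda>i. ?W (Some i))) = random_sum_pmf (law M (?W None)) q"
    by (rule law_random_sum[OF ind]) (auto simp: with_head_def q)
  moreover have rs: "random_sum (?W None) (\<lambda>i. ?W (Some i)) = random_sum X' Bs"
    by (auto simp: random_sum_def with_head_def fun_eq_iff)
  ultimately have lawR: "law M (random_sum X' Bs) = random_sum_pmf (law M X) q"
    by (simp add: law_cong[OF X'])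
  let ?K = "- {Some 0} :: nat option set"
  have m: "random_sum (\<lambda>f. f None) (\<lambda>i f. f (Some i))
      \<in> measurable (PiM ?K (\<lambda>_. count_space UNIV)) (count_space UNIV)"
    by (rule measurable_random_sum) (auto intro!: measurable_component_singleton)
  have "indep_var (count_space UNIV) (\<lambda>\<omega>. (\<lambda>f. f (Some 0)) (restrict (\<lambda>i. ?W i \<omega>) {Some 0}))
      (count_space UNIV) (\<lambda>\<omega>. random_sum (\<lambda>f. f None) (\<lambda>i f. f (Some i)) (restrict (\<lambda>i. ?W i \<omega>) ?K))"
    by (rule indep_var_of_disjoint[OF ind _ _ _ _ m])
       (auto intro!: measurable_component_singleton)
  moreover have "random_sum (\<lambda>f. f None) (\<lambda>i f. f (Some i)) (restrict (\<lambda>i. ?W i \<omega>) ?K)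
      = random_sum X' Bs \<omega>" for \<omega>
    by (auto simp: random_sum_def with_head_def)
  ultimately have "indep_var (count_space UNIV) A (count_space UNIV) (random_sum X' Bs)"
    by (simp add: with_head_def cong: if_cong)
  from law_add[OF this] show ?thesis by (simp add: law_cong[OF eq] lawR)
qed

end

lemma (in branching_tail) partial_mean_tail_tendsto_0:
  assumes a: "0 < a" "a \<le> 1"
  shows "((\<lambda>x. x * (partial_mean p (x / a) * (k * tail_pmf q x))) \<longlongrightarrow> 0) at_top"
proof -
  obtain C where C: "0 \<le> C" "\<And>K. 1 \<le> K \<Longrightarrow> truncated_mean p K \<le> C * (2 + ln K)"
    using truncated_mean_log_bound[OF tail_p] by blast
  define M where "M = C * (3 + \<bar>ln a\<bar>)"
  have "((\<lambda>x. M * \<bar>k\<bar> * (x * ln x * tail_pmf q x)) \<longlongrightarrow> 0) at_top"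
    by (rule tendsto_mult_right_zero[OF tail_q])
  then show ?thesis
  proof (rule Lim_null_comparison[rotated])
    show "\<forall>\<^sub>F x in at_top. norm (x * (partial_mean p (x / a) * (k * tail_pmf q x)))
        \<le> M * \<bar>k\<bar> * (x * ln x * tail_pmf q x)"
      using eventually_ge_at_top[of "exp 1"]
    proof eventually_elim
      case (elim x)
      have "(1 :: real) \<le> exp 1" by simp
      then have x: "1 \<le> x" "1 \<le> ln x" using elim by (simp_all add: ln_ge_iff del: one_le_exp_iff)
      have K: "1 \<le> x / a" using a x by (simp add: field_simps)
      have "partial_mean p (x / a) \<le> truncated_mean p (x / a)"
        by (rule partial_mean_le_truncated_mean) (use K in linarith)
      also have "\<dots> \<le> C * (2 + ln (x / a))" by (rule C(2)[OF K])
      also have "\<dots> \<le> C * ((3 + \<bar>ln a\<bar>) * ln x)"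
        using x a by (intro mult_left_mono log_scaled_bound C(1)) auto
      finally have pm: "partial_mean p (x / a) \<le> M * ln x" by (simp add: M_def)
      have "norm (x * (partial_mean p (x / a) * (k * tail_pmf q x)))
          = (x * \<bar>k\<bar> * tail_pmf q x) * partial_mean p (x / a)"
        using x by (simp add: abs_mult partial_mean_nonneg)
      also have "\<dots> \<le> (x * \<bar>k\<bar> * tail_pmf q x) * (M * ln x)"
        using x by (intro mult_left_mono pm) auto
      finally show ?case by (simp add: mult_ac)
    qed
  qed
qed

lemma asymp_equiv_of_scaled_limits:
  fixes f g :: "real \<Rightarrow> real"
  assumes "((\<lambda>x. x * f x) \<longlongrightarrow> c) at_top" "((\<lambda>x. x * g x) \<longlongrightarrow> c) at_top" "c \<noteq> 0"
  shows "f \<sim>[at_top] g"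
proof (rule asymp_equivI')
  have "((\<lambda>x. (x * f x) / (x * g x)) \<longlongrightarrow> c / c) at_top"
    using assms by (intro tendsto_divide)
  then have "((\<lambda>x. (x * f x) / (x * g x)) \<longlongrightarrow> 1) at_top" using assms(3) by simp
  then show "((\<lambda>x. f x / g x) \<longlongrightarrow> 1) at_top"
    by (rule Lim_transform_eventually) (use eventually_gt_at_top[of 0] in eventually_elim, simp)
qed

theorem theorem3p8:
  fixes M :: "'a measure"
    and A B X :: "'a \<Rightarrow> nat"
    and Bs As :: "nat \<Rightarrow> 'a \<Rightarrow> nat"
    and D :: "nat \<Rightarrow> nat \<Rightarrow> 'a \<Rightarrow> nat"
    and L :: "real \<Rightarrow> real"
    and \<epsilon> b :: real
  assumes "prob_space M"
    and "\<forall>i\<ge>1. eq_law M (Bs i) B"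
    and "indep_nat_vars M (with_head A Bs) UNIV"
    and "tail M A \<sim>[at_top] (\<lambda>x. 1 / (1 + x))"
    and "\<forall>x>0. tail M B x = L x / (1 + x)"
    and "slowly_varying L"
    and "\<epsilon> > 0"
    and "L \<sim>[at_top] (\<lambda>x. ln x powr (- 1 - \<epsilon>))"
    and "integrable M (\<lambda>\<omega>. real (B \<omega>))"
    and "b = (\<integral>\<omega>. real (B \<omega>) \<partial>M)"
    and "0 < b" and "b < 1"
    and "fixed_point M X A Bs"
    and "branching_aggregates M B D"
    and "\<forall>n\<ge>1. eq_law M (As n) A"
    and "indep_nat_vars M (\<lambda>(n, i). with_head (As n) (D n) i) ({1..} \<times> UNIV)"
  shows "(\<forall>\<^sub>F x in at_top. (\<lambda>n. tail M (random_sum (As (n + 1)) (D n)) x) summable_on {1..})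
    \<and> tail M X \<sim>[at_top]
        (\<lambda>x. tail M A x + (\<Sum>\<^sub>\<infinity>n\<in>{1..}. tail M (random_sum (As (n + 1)) (D n)) x))
    \<and> (\<forall>n\<ge>1. tail M (random_sum (As (n + 1)) (D n)) \<sim>[at_top]
        (\<lambda>x. (\<integral>\<omega>. real (A \<omega>) * of_bool (real (A \<omega>) \<le> x / b ^ n) \<partial>M)
               * (real n * b ^ (n - 1) * tail M B x)
             + tail M A (x / b ^ n)))"
proof -
  interpret prob_space M by fact
  define p q where "p = law M A" and "q = law M B"
  have indD: "indep_nat_vars M (with_head B (D n)) UNIV" if "1 \<le> n" for n
    using assms(14) that by (auto simp: branching_aggregates_def)
  have mA: "A \<in> measurable M (count_space UNIV)"
    using indep_nat_vars_measurable[OF assms(3), of 0] by (simp add: with_head_def[abs_def])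
  have mB: "B \<in> measurable M (count_space UNIV)"
    using indep_nat_vars_measurable[OF indD, of 1 0] by (simp add: with_head_def[abs_def])
  have mX: "X \<in> measurable M (count_space UNIV)"
    using assms(13) by (simp add: fixed_point_def)
  have mAs: "As n \<in> measurable M (count_space UNIV)" if "1 \<le> n" for n
    using indep_nat_vars_measurable[OF assms(16), of "(n, 0)"] that by (simp add: with_head_def[abs_def])
  have mD: "D n i \<in> measurable M (count_space UNIV)" if "1 \<le> n" "1 \<le> i" for n i
    using indep_nat_vars_measurable[OF assms(16), of "(n, i)"] that by (simp add: with_head_def[abs_def])
  have tailA: "tail M A x = tail_pmf p x" and tailB: "tail M B x = tail_pmf q x"
    and tailX: "tail M X x = tail_pmf (law M X) x" for x
    unfolding p_def q_def by (rule tail_eq_tail_pmf, fact)+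
  have tail_p: "((\<lambda>x. x * tail_pmf p x) \<longlongrightarrow> 1) at_top"
  proof -
    have "(\<lambda>x. x * tail M A x) \<sim>[at_top] (\<lambda>x. x * (1 / (1 + x)))"
      by (intro asymp_equiv_mult asymp_equiv_refl assms(4))
    moreover have "((\<lambda>x :: real. x * (1 / (1 + x))) \<longlongrightarrow> 1) at_top" by real_asymp
    ultimately show ?thesis by (subst (asm) tendsto_asymp_equiv_cong[symmetric]) (simp_all add: tailA)
  qed
  have tail_q: "((\<lambda>x. x * ln x * tail_pmf q x) \<longlongrightarrow> 0) at_top"
  proof -
    have "(\<lambda>x. x * ln x / (1 + x) * L x) \<sim>[at_top] (\<lambda>x. x * ln x / (1 + x) * ln x powr (- 1 - \<epsilon>))"
      by (intro asymp_equiv_mult asymp_equiv_refl assms(8))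
    moreover have "((\<lambda>x :: real. x * ln x / (1 + x) * ln x powr (- 1 - \<epsilon>)) \<longlongrightarrow> 0) at_top"
      using assms(7) by real_asymp
    ultimately have "((\<lambda>x. x * ln x / (1 + x) * L x) \<longlongrightarrow> 0) at_top"
      by (subst tendsto_asymp_equiv_cong)
    then show ?thesis
    proof (rule Lim_transform_eventually)
      show "\<forall>\<^sub>F x in at_top. x * ln x / (1 + x) * L x = x * ln x * tail_pmf q x"
        using eventually_gt_at_top[of 0]
        by eventually_elim (use assms(5) tailB in simp)
    qed
  qed
  interpret branching_tail p q b
  proof
    show "integrable (measure_pmf q) real"
      using assms(9) by (simp add: q_def measure_pmf_law[OF mB] integrable_distr_eq mB)
    show "measure_pmf.expectation q real = b"
      using assms(10) by (simp add: q_def measure_pmf_law[OF mB] integral_distr mB)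
  qed (fact tail_p tail_q assms(11,12))+
  define S where "S = (\<lambda>n. random_sum (As (n + 1)) (D n))"
  define d where "d = (\<lambda>n. law M (D n 1))"
  have d: "law M (D n i) = d n" if "1 \<le> n" "1 \<le> i" for n i
  proof (cases "n = 1")
    case True
    then show ?thesis using assms(14) that by (auto simp: branching_aggregates_def law_def eq_law_def d_def)
  next
    case False
    then have m: "n = Suc (n - 1)" "1 \<le> n - 1" using that by auto
    have step: "law M (D (Suc m) j) = law M (random_sum B (D m))" if "1 \<le> m" "1 \<le> j" for m j
      using assms(14) that unfolding branching_aggregates_def Suc_eq_plus1 by (blast intro: law_cong)
    have "law M (D (Suc (n - 1)) i) = law M (D (Suc (n - 1)) 1)"
      by (simp only: step[OF m(2) that(2)] step[OF m(2) order.refl])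
    then show ?thesis by (simp only: m(1)[symmetric] d_def)
  qed
  have d1: "d 1 = q"
    using assms(14) by (auto simp: branching_aggregates_def law_def eq_law_def q_def d_def)
  have dSuc: "d (n + 1) = random_sum_pmf q (d n)" if n: "1 \<le> n" for n
  proof -
    have "d (n + 1) = law M (random_sum B (D n))"
      using assms(14) n by (auto simp: d_def branching_aggregates_def intro!: law_cong)
    also have "random_sum B (D n) = random_sum (with_head B (D n) 0) (\<lambda>i. with_head B (D n) i)"
      by (auto simp: random_sum_def with_head_def fun_eq_iff)
    also have "law M \<dots> = random_sum_pmf (law M (with_head B (D n) 0)) (d n)"
      by (rule law_random_sum[OF indD[OF n]]) (auto simp: with_head_def[abs_def] d[OF n])
    finally show ?thesis by (simp add: q_def with_head_def[abs_def])
  qed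
  have lawS: "law M (S n) = aggregate_pmf p q n" if n: "1 \<le> n" for n
  proof -
    let ?W = "\<lambda>(n, i). with_head (As n) (D n) i"
    have S: "S n = random_sum (?W (n + 1, 0)) (\<lambda>i. ?W (n, i))"
      by (auto simp: S_def random_sum_def with_head_def fun_eq_iff)
    have "law M (S n) = random_sum_pmf (law M (?W (n + 1, 0))) (d n)"
      unfolding S
      by (rule law_random_sum[OF assms(16), of "(n + 1, 0)" "Pair n"])
         (use n in \<open>auto simp: with_head_def[abs_def] d[OF n] inj_on_def\<close>)
    moreover have "law M (?W (n + 1, 0)) = p"
      using assms(15) by (auto simp: with_head_def[abs_def] p_def intro!: law_cong)
    ultimately show ?thesis
      using random_sum_pmf_eq_aggregate_pmf[where d = d and p = p, OF d1 dSuc n] by (simp only:)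
  qed
  have tailS: "tail M (S n) x = tail_pmf (aggregate_pmf p q n) x" if n: "1 \<le> n" for n x
  proof -
    have "S n \<in> measurable M (count_space UNIV)"
      unfolding S_def using n by (intro measurable_random_sum mAs mD) auto
    then show ?thesis
      by (simp only: tail_eq_tail_pmf lawS[OF n])
  qed
  have bij: "bij_betw Suc UNIV {1..}"
    by (rule bij_betwI[where g = "\<lambda>n. n - 1"]) auto
  have has_sum: "\<forall>\<^sub>F x in at_top. (\<lambda>n. tail M (S n) x) summable_on {1..} \<and>
      (\<Sum>n. tail_pmf (aggregate_pmf p q (Suc n)) x) = (\<Sum>\<^sub>\<infinity>n\<in>{1..}. tail M (S n) x)"
    using aggregate_pmf_tail_sum(1)
  proof eventually_elim
    case (elim x)
    have tail: "tail M (S (Suc n)) x = tail_pmf (aggregate_pmf p q (Suc n)) x" for n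
      by (rule tailS) simp
    have "((\<lambda>n. tail_pmf (aggregate_pmf p q (Suc n)) x) has_sum
        (\<Sum>n. tail_pmf (aggregate_pmf p q (Suc n)) x)) UNIV"
      by (rule sums_nonneg_imp_has_sum[OF summable_sums[OF elim]]) simp
    then have "((\<lambda>n. tail M (S (Suc n)) x) has_sum
        (\<Sum>n. tail_pmf (aggregate_pmf p q (Suc n)) x)) UNIV"
      by (simp only: tail)
    then have "((\<lambda>n. tail M (S n) x) has_sum
        (\<Sum>n. tail_pmf (aggregate_pmf p q (Suc n)) x)) {1..}"
      using has_sum_reindex_bij_betw[OF bij, of "\<lambda>n. tail M (S n) x"] by simp
    then show ?case by (auto simp: summable_on_def infsumI)
  qed
  have "((\<lambda>x. x * tail_pmf p x + x * (\<Sum>n. tail_pmf (aggregate_pmf p q (Suc n)) x))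
      \<longlongrightarrow> 1 + b / (1 - b)) at_top"
    by (intro tendsto_add tail_p aggregate_pmf_tail_sum(2))
  then have sum_lim: "((\<lambda>x. x * (tail M A x + (\<Sum>\<^sub>\<infinity>n\<in>{1..}. tail M (S n) x)))
      \<longlongrightarrow> 1 + b / (1 - b)) at_top"
    by (rule Lim_transform_eventually)
       (use has_sum in eventually_elim, simp add: tailA distrib_left)
  have "law M X = conv_pmf p (random_sum_pmf (law M X) q)"
    unfolding p_def q_def by (rule law_fixed_point[OF assms(13)]) (use assms(2) in \<open>auto intro!: law_cong\<close>)
  from fixed_point_tail[OF this] have X_lim: "((\<lambda>x. x * tail M X x) \<longlongrightarrow> 1 + b / (1 - b)) at_top"
    using b by (simp add: tailX field_simps)
  have "1 + b / (1 - b) \<noteq> 0" using b by (simp add: field_simps)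
  note X_asymp = asymp_equiv_of_scaled_limits[OF X_lim sum_lim this]
  have S_asymp: "tail M (S n) \<sim>[at_top]
        (\<lambda>x. (\<integral>\<omega>. real (A \<omega>) * of_bool (real (A \<omega>) \<le> x / b ^ n) \<partial>M)
               * (real n * b ^ (n - 1) * tail M B x) + tail M A (x / b ^ n))" if n: "1 \<le> n" for n
  proof (rule asymp_equiv_of_scaled_limits)
    show "((\<lambda>x. x * tail M (S n) x) \<longlongrightarrow> b ^ n) at_top"
      unfolding tailS[OF n] by (rule aggregate_pmf_tail)
    have pm: "(\<integral>\<omega>. real (A \<omega>) * of_bool (real (A \<omega>) \<le> y) \<partial>M) = partial_mean p y" for y
      unfolding partial_mean_def p_def measure_pmf_law[OF mA] by (subst integral_distr) (simp_all add: mA)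
    have "((\<lambda>x. x * tail_pmf p (inverse (b ^ n) * x)) \<longlongrightarrow> 1 / inverse (b ^ n)) at_top"
      by (rule tendsto_scaled_tail[OF tail_p]) (use b in simp)
    then have "((\<lambda>x. x * tail_pmf p (x / b ^ n)) \<longlongrightarrow> b ^ n) at_top"
      by (simp add: divide_inverse mult.commute)
    then have "((\<lambda>x. x * (partial_mean p (x / b ^ n) * (real n * b ^ (n - 1) * tail_pmf q x))
        + x * tail_pmf p (x / b ^ n)) \<longlongrightarrow> 0 + b ^ n) at_top"
      using b by (intro tendsto_add partial_mean_tail_tendsto_0) (auto intro: power_le_one)
    then show "((\<lambda>x. x * ((\<integral>\<omega>. real (A \<omega>) * of_bool (real (A \<omega>) \<le> x / b ^ n) \<partial>M)
               * (real n * b ^ (n - 1) * tail M B x) + tail M A (x / b ^ n))) \<longlongrightarrow> b ^ n) at_top"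
      by (simp add: pm tailA tailB distrib_left)
  qed (use b in simp)
  show ?thesis
    using has_sum X_asymp S_asymp unfolding S_def by (auto elim: eventually_mono)
qed

end
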